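(* Let $x\in[0,1)$, $\mu:[0,\infty)\to\mathbb R$, $\lambda:[0,\infty)\to[0,\infty)$, let $\pi$ be a probability measure on the type set $\Theta$, and let $$\mathcal K^{\mathrm{uniq}}:=[0,p_{\max}]\times[\alpha_{\min},\alpha_{\max}]\times[0,\beta_{\max}],\qquad 0\le p_{\max}<\infty,\ 0<\alpha_{\min}\le\alpha_{\max}<\infty,\ 0\le\beta_{\max}<1.$$ Assume: (U1) there is a maximal effort $E_{\max}<\infty$, so that all efforts and the mean-field effort $\tilde m$ are restricted to $[0,E_{\max}]$; (U2) $\mu,\lambda$ are continuous, strictly convex and Lipschitz on $[0,(1+x)E_{\max}]$, with Lipschitz constants $L_\mu,L_\lambda>0$; (U3) $\Theta=[\gamma_{\min},\gamma_{\max}]\times[0,c_{\max}]\times[\sigma_{\min},\sigma_{\max}]$ with $0<\gamma_{\min}<\gamma_{\max}<\infty$, $0<c_{\max}<\infty$, $0<\sigma_{\min}<\sigma_{\max}<\infty$, and $\theta=(\gamma,c,\sigma)$; (U5) $\pi$ has a density $f$ with respect to Lebesgue measure on $\Theta$ with $\|f\|_\infty\le C_f<\infty$; (U6, uniform) for $k=(p,\alpha,\beta)\in\mathcal K^{\mathrm{uniq}}$, set $c_\sigma(k):=\gamma_{\min}\alpha^2\sigma_{\min}$, $C_m(k):=x\big(2c_{\max}+\alpha+(2-\beta)L_\mu+\tfrac12\gamma_{\max}((1-\beta)^2+1)L_\lambda\big)$, $C_q(k):=\frac{C_f}{c_\sigma(k)}(\gamma_{\max}-\gamma_{\min})\,c_{\max}\,C_m(k)$;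 then $$\sup_{k\in\mathcal K^{\mathrm{uniq}}}\big(3x+E_{\max}C_q(k)\big)<1.$$ Then, for every $k\in\mathcal K^{\mathrm{uniq}}$, the lower-level mean-field game admits a unique mean-field Nash equilibrium up to $\pi$-a.e. equality; denote it $M(k)\in\mathcal M(k)$, choosing any representative of the participation probability $q(\cdot;k)$ within its $\pi$-a.e. equivalence class. The function $$\mathcal J^{\mathrm{uniq}}(k):=J(k;M(k))$$ is well defined and continuous on $\mathcal K^{\mathrm{uniq}}$. Consequently there exists $k^*\in\mathcal K^{\mathrm{uniq}}$ with $$\mathcal J^{\mathrm{uniq}}(k^* )=\max_{k\in\mathcal K^{\mathrm{uniq}}}\mathcal J^{\mathrm{uniq}}(k),$$ and thus the pair $(k^*,M(k^* ))$ is an exact Stackelberg equilibrium under the unique lower-level equilibrium response.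
   Context: For a contract $k=(p,\alpha,\beta)$, $e,\tilde m\in[0,E_{\max}]$ and $\theta=(\gamma,c,\sigma)\in\Theta$ define $$\mathrm{CE}^{\mathrm{out}}(e;\theta,\tilde m)=\mu(e+x\tilde m)+c\,e+\tfrac12\gamma\lambda(e+x\tilde m),$$ $$\mathrm{CE}^{\mathrm{in}}(e;\theta,\tilde m)=p+(c-\alpha)e+\tfrac12\gamma\alpha^2\sigma^2+(1-\beta)\mu(e+x\tilde m)+\tfrac12\gamma(1-\beta)^2\lambda(e+x\tilde m),$$ $U^{\mathrm{out}}=-\exp\{\gamma\,\mathrm{CE}^{\mathrm{out}}\}$, $U^{\mathrm{in}}=-\exp\{\gamma\,\mathrm{CE}^{\mathrm{in}}\}$, $E^{\mathrm{out}}(\theta;\tilde m)=\arg\min_{e\in[0,E_{\max}]}\mathrm{CE}^{\mathrm{out}}(e;\theta,\tilde m)$ and $E^{\mathrm{in}}(\theta;\tilde m)=\arg\min_{e\in[0,E_{\max}]}\mathrm{CE}^{\mathrm{in}}(e;\theta,\tilde m)$. $\mathcal M(k)$ is the set of mean-field Nash equilibria $M=(\tilde m,\{e^{\mathrm{in}}(\theta),e^{\mathrm{out}}(\theta),q(\theta)\}_{\theta\in\Theta})$ of the lower-level game under $k$, i.e. tuples with $\tilde m\in[0,E_{\max}]$ and measurable components such that (1) $e^{\mathrm{out}}(\theta)\in E^{\mathrm{out}}(\theta;\tilde m)$, $e^{\mathrm{in}}(\theta)\in E^{\mathrm{in}}(\theta;\tilde m)$ for every $\theta$; (2) $q(\theta)\in[0,1]$,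 $q(\theta)=1$ if $U^{\mathrm{in}}(e^{\mathrm{in}}(\theta);\theta,\tilde m)>U^{\mathrm{out}}(e^{\mathrm{out}}(\theta);\theta,\tilde m)$, $q(\theta)=0$ if the strict inequality is reversed, arbitrary in $[0,1]$ in case of equality; (3) $\tilde m=\int_\Theta[q(\theta)e^{\mathrm{in}}(\theta)+(1-q(\theta))e^{\mathrm{out}}(\theta)]\,d\pi(\theta)$. "Unique up to $\pi$-a.e. equality" means any two equilibria have the same $\tilde m$ and their functions coincide for $\pi$-a.e. $\theta$. The insurer's per-capita expected profit is $$J(k;M)=\int_\Theta\big(p-\alpha e^{\mathrm{in}}(\theta)-\beta\mu(e^{\mathrm{in}}(\theta)+x\tilde m)\big)q(\theta)\,d\pi(\theta).$$ Exact Stackelberg equilibrium (under the unique response): a pair $(k^*,M(k^* ))$ such that $M(k^* )$ is the ($\pi$-a.e. unique) mean-field Nash equilibrium under $k^*$, and $k^*$ maximizes $k\mapsto J(k;M(k))$ over $\mathcal K^{\mathrm{uniq}}$. *)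

theory Defs
  imports "HOL-Probability.Probability"
begin

text \<open>A contract is a triple (p, alpha, beta); an agent type is a triple (gamma, c, sigma).\<close>

type_synonym contract = "real \<times> real \<times> real"
type_synonym agent = "real \<times> real \<times> real"

definition strictly_convex_on :: "real set \<Rightarrow> (real \<Rightarrow> real) \<Rightarrow> bool" where
  "strictly_convex_on S g \<longleftrightarrow> convex S \<and>
     (\<forall>y\<in>S. \<forall>z\<in>S. y \<noteq> z \<longrightarrow>
        (\<forall>t. 0 < t \<and> t < 1 \<longrightarrow> g ((1 - t) * y + t * z) < (1 - t) * g y + t * g z))"

definition CE_out ::
  "real \<Rightarrow> (real \<Rightarrow> real) \<Rightarrow> (real \<Rightarrow> real) \<Rightarrow> real \<Rightarrow> agent \<Rightarrow> real \<Rightarrow> real" where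
  "CE_out x \<mu> lam e \<theta> m = (case \<theta> of (\<gamma>, c, \<sigma>) \<Rightarrow>
     \<mu> (e + x * m) + c * e + 1/2 * \<gamma> * lam (e + x * m))"

definition CE_in ::
  "real \<Rightarrow> (real \<Rightarrow> real) \<Rightarrow> (real \<Rightarrow> real) \<Rightarrow> contract \<Rightarrow> real \<Rightarrow> agent \<Rightarrow> real \<Rightarrow> real" where
  "CE_in x \<mu> lam k e \<theta> m = (case k of (p, \<alpha>, \<beta>) \<Rightarrow> case \<theta> of (\<gamma>, c, \<sigma>) \<Rightarrow>
     p + (c - \<alpha>) * e + 1/2 * \<gamma> * \<alpha>\<^sup>2 * \<sigma>\<^sup>2
       + (1 - \<beta>) * \<mu> (e + x * m) + 1/2 * \<gamma> * (1 - \<beta>)\<^sup>2 * lam (e + x * m))"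

definition U_out ::
  "real \<Rightarrow> (real \<Rightarrow> real) \<Rightarrow> (real \<Rightarrow> real) \<Rightarrow> real \<Rightarrow> agent \<Rightarrow> real \<Rightarrow> real" where
  "U_out x \<mu> lam e \<theta> m = - exp (fst \<theta> * CE_out x \<mu> lam e \<theta> m)"

definition U_in ::
  "real \<Rightarrow> (real \<Rightarrow> real) \<Rightarrow> (real \<Rightarrow> real) \<Rightarrow> contract \<Rightarrow> real \<Rightarrow> agent \<Rightarrow> real \<Rightarrow> real" where
  "U_in x \<mu> lam k e \<theta> m = - exp (fst \<theta> * CE_in x \<mu> lam k e \<theta> m)"

definition E_out ::
  "real \<Rightarrow> (real \<Rightarrow> real) \<Rightarrow> (real \<Rightarrow> real) \<Rightarrow> real \<Rightarrow> agent \<Rightarrow> real \<Rightarrow> real set" where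
  "E_out x \<mu> lam Emax \<theta> m =
     {e. is_arg_min (\<lambda>e. CE_out x \<mu> lam e \<theta> m) (\<lambda>e. e \<in> {0..Emax}) e}"

definition E_in ::
  "real \<Rightarrow> (real \<Rightarrow> real) \<Rightarrow> (real \<Rightarrow> real) \<Rightarrow> real \<Rightarrow> contract \<Rightarrow> agent \<Rightarrow> real \<Rightarrow> real set" where
  "E_in x \<mu> lam Emax k \<theta> m =
     {e. is_arg_min (\<lambda>e. CE_in x \<mu> lam k e \<theta> m) (\<lambda>e. e \<in> {0..Emax}) e}"

record mf_profile =
  mean_effort :: real
  effort_in :: "agent \<Rightarrow> real"
  effort_out :: "agent \<Rightarrow> real"
  participation :: "agent \<Rightarrow> real"

text \<open>
  The type set is the underlying space of the type distribution \<open>\<pi>\<close>; values of the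
  profile functions outside of it are irrelevant.
\<close>

definition mf_equilibria ::
  "real \<Rightarrow> (real \<Rightarrow> real) \<Rightarrow> (real \<Rightarrow> real) \<Rightarrow> real \<Rightarrow> agent measure \<Rightarrow> contract \<Rightarrow> mf_profile set"
  where
  "mf_equilibria x \<mu> lam Emax \<pi> k = {M.
     mean_effort M \<in> {0..Emax} \<and>
     effort_in M \<in> borel_measurable \<pi> \<and>
     effort_out M \<in> borel_measurable \<pi> \<and>
     participation M \<in> borel_measurable \<pi> \<and>
     (\<forall>\<theta>\<in>space \<pi>.
        effort_out M \<theta> \<in> E_out x \<mu> lam Emax \<theta> (mean_effort M) \<and>
        effort_in M \<theta> \<in> E_in x \<mu> lam Emax k \<theta> (mean_effort M)) \<and>
     (\<forall>\<theta>\<in>space \<pi>.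
        participation M \<theta> \<in> {0..1} \<and>
        (U_in x \<mu> lam k (effort_in M \<theta>) \<theta> (mean_effort M)
           > U_out x \<mu> lam (effort_out M \<theta>) \<theta> (mean_effort M) \<longrightarrow> participation M \<theta> = 1) \<and>
        (U_in x \<mu> lam k (effort_in M \<theta>) \<theta> (mean_effort M)
           < U_out x \<mu> lam (effort_out M \<theta>) \<theta> (mean_effort M) \<longrightarrow> participation M \<theta> = 0)) \<and>
     mean_effort M =
       (\<integral>\<theta>. (participation M \<theta> * effort_in M \<theta>
              + (1 - participation M \<theta>) * effort_out M \<theta>) \<partial>\<pi>)}"

definition ae_equal_profiles :: "agent measure \<Rightarrow> mf_profile \<Rightarrow> mf_profile \<Rightarrow> bool" where
  "ae_equal_profiles \<pi> M M' \<longleftrightarrow>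
     mean_effort M = mean_effort M' \<and>
     (AE \<theta> in \<pi>. effort_in M \<theta> = effort_in M' \<theta> \<and>
                effort_out M \<theta> = effort_out M' \<theta> \<and>
                participation M \<theta> = participation M' \<theta>)"

definition has_ae_unique_equilibrium ::
  "real \<Rightarrow> (real \<Rightarrow> real) \<Rightarrow> (real \<Rightarrow> real) \<Rightarrow> real \<Rightarrow> agent measure \<Rightarrow> contract \<Rightarrow> bool"
  where
  "has_ae_unique_equilibrium x \<mu> lam Emax \<pi> k \<longleftrightarrow>
     mf_equilibria x \<mu> lam Emax \<pi> k \<noteq> {} \<and>
     (\<forall>M\<in>mf_equilibria x \<mu> lam Emax \<pi> k. \<forall>M'\<in>mf_equilibria x \<mu> lam Emax \<pi> k.
        ae_equal_profiles \<pi> M M')"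

definition insurer_profit ::
  "real \<Rightarrow> (real \<Rightarrow> real) \<Rightarrow> agent measure \<Rightarrow> contract \<Rightarrow> mf_profile \<Rightarrow> real" where
  "insurer_profit x \<mu> \<pi> k M = (case k of (p, \<alpha>, \<beta>) \<Rightarrow>
     (\<integral>\<theta>. (p - \<alpha> * effort_in M \<theta> - \<beta> * \<mu> (effort_in M \<theta> + x * mean_effort M))
            * participation M \<theta> \<partial>\<pi>))"

text \<open>
  \<open>R\<close> is the lower-level response: it assigns to each contract in \<open>K\<close> a representative
  of its almost everywhere unique equilibrium.
\<close>

definition exact_stackelberg ::
  "real \<Rightarrow> (real \<Rightarrow> real) \<Rightarrow> (real \<Rightarrow> real) \<Rightarrow> real \<Rightarrow> agent measure \<Rightarrow> contract set \<Rightarrow>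
   (contract \<Rightarrow> mf_profile) \<Rightarrow> contract \<times> mf_profile \<Rightarrow> bool" where
  "exact_stackelberg x \<mu> lam Emax \<pi> K R = (\<lambda>(k, M).
     (\<forall>k'\<in>K. has_ae_unique_equilibrium x \<mu> lam Emax \<pi> k' \<and>
             R k' \<in> mf_equilibria x \<mu> lam Emax \<pi> k') \<and>
     k \<in> K \<and> M = R k \<and>
     (\<forall>k'\<in>K. insurer_profit x \<mu> \<pi> k' (R k') \<le> insurer_profit x \<mu> \<pi> k (R k)))"

definition c_sigma :: "real \<Rightarrow> real \<Rightarrow> contract \<Rightarrow> real" where
  "c_sigma \<gamma>min \<sigma>min k = (case k of (p, \<alpha>, \<beta>) \<Rightarrow> \<gamma>min * \<alpha>\<^sup>2 * \<sigma>min)"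

definition C_m :: "real \<Rightarrow> real \<Rightarrow> real \<Rightarrow> real \<Rightarrow> real \<Rightarrow> contract \<Rightarrow> real" where
  "C_m x \<gamma>max cmax L\<mu> Llam k = (case k of (p, \<alpha>, \<beta>) \<Rightarrow>
     x * (2 * cmax + \<alpha> + (2 - \<beta>) * L\<mu> + 1/2 * \<gamma>max * ((1 - \<beta>)\<^sup>2 + 1) * Llam))"

definition C_q ::
  "real \<Rightarrow> real \<Rightarrow> real \<Rightarrow> real \<Rightarrow> real \<Rightarrow> real \<Rightarrow> real \<Rightarrow> real \<Rightarrow> contract \<Rightarrow> real" where
  "C_q x \<gamma>min \<gamma>max cmax \<sigma>min L\<mu> Llam Cf k =
     Cf / c_sigma \<gamma>min \<sigma>min k * (\<gamma>max - \<gamma>min) * cmax * C_m x \<gamma>max cmax L\<mu> Llam k"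

end

theory Submission
  imports Defs
begin

text \<open>
  Fix a contract and a mean effort \<open>m\<close>. Strict convexity makes the optimal effort of each type
  unique; in the variable \<open>e + x m\<close> the objective does not depend on \<open>m\<close> (up to a constant), so this
  effort is \<open>x\<close>-Lipschitz in \<open>m\<close>. The certainty-equivalent gap between buying and not buying is
  Lipschitz in \<open>m\<close> (envelope argument) and depends on \<open>\<sigma>\<close> only through the term
  \<open>\<gamma> \<alpha>\<^sup>2 \<sigma>\<^sup>2 / 2\<close>. Hence, by Fubini in the \<open>\<sigma>\<close> direction, ties are negligible and the types whose
  decision changes between \<open>m\<close> and \<open>m'\<close> have mass at most \<open>C\<^sub>q \<bar>m - m'\<bar>\<close>. So the map sending \<open>m\<close> to
  the mean optimal effort is a contraction with constant \<open>x + E\<^sub>m\<^sub>a\<^sub>x C\<^sub>q < 1\<close>, and its fixed point is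
  the unique equilibrium. Minimisers and the fixed point depend continuously on the contract because
  their graphs are closed with values in a compact set; since ties are negligible, dominated
  convergence makes the profit continuous, and compactness gives a maximiser.
\<close>

section \<open>Strictly convex functions and their minimisers\<close>

lemma strictly_convex_on_less:
  assumes "strictly_convex_on S g" "y \<in> S" "z \<in> S" "y \<noteq> z" "0 < t" "t < 1"
  shows "g ((1 - t) * y + t * z) < (1 - t) * g y + t * g z"
  using assms unfolding strictly_convex_on_def by blast

lemma strictly_convex_on_unique_min:
  assumes g: "strictly_convex_on S g"
    and y: "y \<in> S" "\<And>w. w \<in> S \<Longrightarrow> g y \<le> g w"
    and z: "z \<in> S" "\<And>w. w \<in> S \<Longrightarrow> g z \<le> g w"
  shows "y = z"
proof (rule ccontr)
  assume ne: "y \<noteq> z"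
  have "convex S" using g by (simp add: strictly_convex_on_def)
  then have "(1 - 1/2) *\<^sub>R y + (1/2) *\<^sub>R z \<in> S"
    using y z by (intro convexD) auto
  then have "g y \<le> g ((1 - 1/2) * y + 1/2 * z)" using y by simp
  also have "\<dots> < (1 - 1/2) * g y + 1/2 * g z"
    using strictly_convex_on_less[OF g y(1) z(1) ne, of "1/2"] by simp
  finally show False using z(2)[OF y(1)] by simp
qed

text \<open>Strictness comes from \<open>g\<close> alone, so the weight of \<open>h\<close> may
  vanish. The affine part absorbs the premium and the terms of the certainty equivalent that are
  linear in the effort.\<close>

lemma strictly_convex_on_affine_combination:
  assumes g: "strictly_convex_on S g" "0 < a" and h: "strictly_convex_on S h" "0 \<le> b"
  shows "strictly_convex_on S (\<lambda>y. d + c * y + a * g y + b * h y)"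
  unfolding strictly_convex_on_def
proof (intro conjI ballI allI impI)
  show "convex S" using g by (simp add: strictly_convex_on_def)
  fix y z t :: real assume *: "y \<in> S" "z \<in> S" "y \<noteq> z" "0 < t \<and> t < 1"
  let ?w = "(1 - t) * y + t * z"
  have "a * g ?w < a * ((1 - t) * g y + t * g z)"
    using strictly_convex_on_less[OF g(1)] * g(2) by simp
  moreover have "b * h ?w \<le> b * ((1 - t) * h y + t * h z)"
    using strictly_convex_on_less[OF h(1)] * h(2) by (intro mult_left_mono) (auto simp: less_imp_le)
  ultimately have "d + c * ?w + a * g ?w + b * h ?w <
      d + c * ?w + a * ((1 - t) * g y + t * g z) + b * ((1 - t) * h y + t * h z)"
    by simp
  also have "\<dots> = (1 - t) * (d + c * y + a * g y + b * h y) + t * (d + c * z + a * g z + b * h z)"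
    by (simp add: algebra_simps)
  finally show "d + c * ?w + a * g ?w + b * h ?w <
    (1 - t) * (d + c * y + a * g y + b * h y) + t * (d + c * z + a * g z + b * h z)" .
qed

lemma strictly_convex_on_shift:
  assumes "strictly_convex_on S g" "convex T" "\<And>y. y \<in> T \<Longrightarrow> y + s \<in> S"
  shows "strictly_convex_on T (\<lambda>y. g (y + s))"
  unfolding strictly_convex_on_def
proof (intro conjI ballI allI impI)
  fix y z t :: real assume *: "y \<in> T" "z \<in> T" "y \<noteq> z" "0 < t \<and> t < 1"
  have "g ((1 - t) * (y + s) + t * (z + s)) < (1 - t) * g (y + s) + t * g (z + s)"
    using * assms by (intro strictly_convex_on_less[OF assms(1)]) auto
  then show "g ((1 - t) * y + t * z + s) < (1 - t) * g (y + s) + t * g (z + s)"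
    by (simp add: algebra_simps)
qed fact

text \<open>A minimiser over the translated window \<open>[s, s + E]\<close> is the projection of the global
  minimiser onto that window, so it moves monotonically and by at most the translation.\<close>
lemma shifted_minimizers_mono:
  fixes g :: "real \<Rightarrow> real"
  assumes g: "strictly_convex_on S g"
    and S: "{s..s + E} \<subseteq> S" "{s'..s' + E} \<subseteq> S" and ss: "s \<le> s'"
    and e: "e \<in> {0..E}" "\<And>w. w \<in> {0..E} \<Longrightarrow> g (e + s) \<le> g (w + s)"
    and e': "e' \<in> {0..E}" "\<And>w. w \<in> {0..E} \<Longrightarrow> g (e' + s') \<le> g (w + s')"
  shows "e' \<le> e \<and> e + s \<le> e' + s'"
proof
  have uniq: "e = w" if "w \<in> {0..E}" "g (w + s) \<le> g (e + s)" for w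
  proof (rule strictly_convex_on_unique_min)
    show "strictly_convex_on {0..E} (\<lambda>w. g (w + s))"
      using S by (intro strictly_convex_on_shift[OF g]) auto
    show "g (w + s) \<le> g (v + s)" if "v \<in> {0..E}" for v
      using \<open>g (w + s) \<le> g (e + s)\<close> e(2)[OF that] by simp
  qed (use that e in auto)
  show "e + s \<le> e' + s'"
  proof (rule ccontr)
    assume less: "\<not> e + s \<le> e' + s'"
    \<comment> \<open>If \<open>e + s\<close> exceeded \<open>e' + s'\<close>, each minimiser would
      lie in the window of the other. Then \<open>g\<close> takes the same minimal value at both
      points, and uniqueness in the window at \<open>s\<close> forces them to coincide.\<close>
    then have "e' + s' - s \<in> {0..E}" "e + s - s' \<in> {0..E}"
      using e(1) e'(1) ss by auto
    from uniq[OF this(1)] e'(2)[OF this(2)] show False using less by simp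
  qed
  show "e' \<le> e"
  proof (rule ccontr)
    assume less: "\<not> e' \<le> e"
    \<comment> \<open>Suppose \<open>e < e'\<close>, so that \<open>y\<close> and \<open>y'\<close>
      are more than \<open>d\<close> apart. The points \<open>y + d\<close> and
      \<open>y' - d\<close> then lie between them with weights \<open>t\<close> and
      \<open>1 - t\<close>, and strict convexity gives
      \<open>g (y + d) + g (y' - d) < g y + g y'\<close> unless \<open>t = 0\<close>. But
      \<open>y + d\<close> belongs to the window of \<open>e'\<close> and \<open>y' - d\<close> to
      that of \<open>e\<close>, so minimality says the opposite.\<close>
    define d where "d = s' - s"
    define y where "y = e + s"
    define y' where "y' = e' + s'"
    define t where "t = d / (y' - y)"
    have pos: "0 < y' - y" "0 \<le> d" "d < y' - y"
      using less ss by (auto simp: d_def y_def y'_def)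
    have t: "0 \<le> t" "t < 1" "t * (y' - y) = d"
      using pos by (auto simp: t_def field_simps)
    have mem: "y \<in> S" "y' \<in> S"
      using S e(1) e'(1) by (auto simp: y_def y'_def)
    have lt: "g y < g (y' - d)"
      using uniq[of e'] less e'(1) by (force simp: y_def y'_def d_def algebra_simps)
    have le: "g y' \<le> g (y + d)"
      using e'(2)[OF e(1)] by (simp add: y_def y'_def d_def algebra_simps)
    show False
    proof (cases "t = 0")
      case True
      then show False using t lt le by simp
    next
      case False
      then have "g ((1 - t) * y + t * y') < (1 - t) * g y + t * g y'"
        "g ((1 - t) * y' + t * y) < (1 - t) * g y' + t * g y"
        using strictly_convex_on_less[OF g] mem pos t by auto
      moreover have "(1 - t) * y + t * y' = y + d" "(1 - t) * y' + t * y = y' - d"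
        using t(3) by (simp_all add: algebra_simps)
      ultimately have "g (y + d) + g (y' - d) < g y + g y'"
        by (simp add: algebra_simps)
      then show False using lt le by simp
    qed
  qed
qed

text \<open>Being a minimiser is a family of closed conditions on \<open>(z, e)\<close>, one for
  each competitor \<open>w\<close>, and uniqueness turns their intersection into the graph of
  \<open>a\<close>. A closed graph with values in a compact set gives continuity.\<close>

lemma continuous_on_unique_minimizer:
  fixes F :: "'a::euclidean_space \<Rightarrow> 'b::euclidean_space \<Rightarrow> real"
  assumes Z: "closed Z" and T: "compact T"
    and cont: "continuous_on (Z \<times> T) (\<lambda>(z, e). F z e)"
    and mem: "\<And>z. z \<in> Z \<Longrightarrow> a z \<in> T"
    and min: "\<And>z e. z \<in> Z \<Longrightarrow> e \<in> T \<Longrightarrow> F z (a z) \<le> F z e"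
    and uniq: "\<And>z e. z \<in> Z \<Longrightarrow> e \<in> T \<Longrightarrow> (\<And>w. w \<in> T \<Longrightarrow> F z e \<le> F z w) \<Longrightarrow> e = a z"
  shows "continuous_on Z a"
proof (rule continuous_from_closed_graph[OF T])
  show "a \<in> Z \<rightarrow> T" using mem by auto
  have "(\<lambda>z. (z, a z)) ` Z =
      Z \<times> T \<inter> (\<Inter>w\<in>T. {q \<in> Z \<times> T. (case q of (z, e) \<Rightarrow> F z e) \<le> F (fst q) w})"
    (is "?G = ?H")
  proof (intro set_eqI iffI)
    fix q assume "q \<in> ?G"
    then show "q \<in> ?H" using mem min by auto
  next
    fix q assume q: "q \<in> ?H"
    obtain z e where ze: "q = (z, e)" by fastforce
    have "e = a z" using q by (intro uniq) (auto simp: ze)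
    then show "q \<in> ?G" using q ze by auto
  qed
  also have "closed \<dots>"
  proof (intro closed_Int closed_INT ballI closed_Times continuous_on_closed_Collect_le cont)
    fix w assume "w \<in> T"
    then have "continuous_on (Z \<times> T) (\<lambda>q. (\<lambda>(z, e). F z e) (fst q, w))"
      by (intro continuous_on_compose2[OF cont] continuous_intros) auto
    then show "continuous_on (Z \<times> T) (\<lambda>q. F (fst q) w)" by simp
  qed (use Z T compact_imp_closed in auto)
  finally show "closed ((\<lambda>z. (z, a z)) ` Z)" .
qed

section \<open>Lebesgue measure of sets where two functions differ in sign\<close>

lemma emeasure_lborel_small_diameter_le:
  fixes S :: "real set"
  assumes "\<And>s s'. s \<in> S \<Longrightarrow> s' \<in> S \<Longrightarrow> s < s' \<Longrightarrow> s' - s \<le> L" "0 \<le> L" "bdd_below S"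
  shows "emeasure lborel S \<le> ennreal L"
proof (cases "S = {}")
  case False
  \<comment> \<open>An interval of length \<open>L\<close> starting at the infimum covers
    \<open>S\<close>, which reduces the bound to the length of an interval.\<close>
  have "S \<subseteq> {Inf S..Inf S + L}"
  proof
    fix s assume s: "s \<in> S"
    have "s - L \<le> Inf S"
    proof (rule cInf_greatest[OF False])
      fix s' assume "s' \<in> S"
      then show "s - L \<le> s'" using assms(1)[OF _ s, of s'] assms(2) by (cases "s' < s") auto
    qed
    then show "s \<in> {Inf S..Inf S + L}" using cInf_lower[OF s assms(3)] by simp
  qed
  then have "emeasure lborel S \<le> emeasure lborel {Inf S..Inf S + L}"
    by (intro emeasure_mono) auto
  also have "\<dots> = ennreal L" using assms(2) by simp
  finally show ?thesis .
qed simp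

text \<open>Along the last coordinate both functions grow at rate at least \<open>C\<close> and stay \<open>\<delta>\<close>-close, so
  every fibre of the set where they have opposite signs has diameter at most \<open>\<delta> / C\<close>.\<close>
lemma emeasure_sign_change_le:
  fixes g h :: "real \<times> real \<times> real \<Rightarrow> real"
  assumes \<Theta>: "\<Theta> = {a1..b1} \<times> {a2..b2} \<times> {a3..b3}" and ab: "a1 \<le> b1" "a2 \<le> b2"
    and cont: "continuous_on \<Theta> g" "continuous_on \<Theta> h"
    and C: "0 < C"
    and slope: "\<And>u v s s'. (u, v, s) \<in> \<Theta> \<Longrightarrow> (u, v, s') \<in> \<Theta> \<Longrightarrow> s < s' \<Longrightarrow>
        C * (s' - s) \<le> g (u, v, s') - g (u, v, s) \<and> C * (s' - s) \<le> h (u, v, s') - h (u, v, s)"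
    and close: "\<And>\<theta>. \<theta> \<in> \<Theta> \<Longrightarrow> \<bar>g \<theta> - h \<theta>\<bar> \<le> \<delta>" and \<delta>: "0 \<le> \<delta>"
  shows "emeasure lborel {\<theta>\<in>\<Theta>. g \<theta> * h \<theta> \<le> 0} \<le> ennreal ((b1 - a1) * (b2 - a2) * (\<delta> / C))"
proof -
  define S where "S = {\<theta>\<in>\<Theta>. g \<theta> * h \<theta> \<le> 0}"
  have "closed S"
    unfolding S_def using cont
    by (intro continuous_on_closed_Collect_le continuous_intros) (auto simp: \<Theta> intro!: closed_Times)
  then have S[measurable]: "S \<in> sets (lborel \<Otimes>\<^sub>M (lborel \<Otimes>\<^sub>M lborel))"
    unfolding lborel_prod by simp
  have fibre: "emeasure lborel (Pair v -` (Pair u -` S)) \<le>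
      ennreal (\<delta> / C) * indicator {a2..b2} v * indicator {a1..b1} u" for u v
  proof (cases "u \<in> {a1..b1} \<and> v \<in> {a2..b2}")
    case True
    have "emeasure lborel {s. (u, v, s) \<in> S} \<le> ennreal (\<delta> / C)"
    proof (rule emeasure_lborel_small_diameter_le)
      fix s s' assume "s \<in> {s. (u, v, s) \<in> S}" "s' \<in> {s. (u, v, s) \<in> S}" and less: "s < s'"
      then have m: "(u, v, s) \<in> \<Theta>" "(u, v, s') \<in> \<Theta>"
        and p: "g (u, v, s) * h (u, v, s) \<le> 0" "g (u, v, s') * h (u, v, s') \<le> 0"
        by (auto simp: S_def)
      \<comment> \<open>One of the two functions is nonnegative at \<open>s\<close> and one is
        nonpositive at \<open>s'\<close>. The former has grown to at least
        \<open>C * (s' - s)\<close> at \<open>s'\<close>, where it exceeds the latter by at most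
        \<delta>; if both are the same function, the growth bound alone suffices.\<close>
      have "C * (s' - s) \<le> \<delta>"
        using p slope[OF m less] close[OF m(1)] close[OF m(2)] unfolding mult_le_0_iff by linarith
      then show "s' - s \<le> \<delta> / C" using C by (simp add: field_simps)
    next
      show "bdd_below {s. (u, v, s) \<in> S}" by (rule bdd_belowI[of _ a3]) (auto simp: S_def \<Theta>)
    qed (use C \<delta> in simp)
    then show ?thesis using True by (simp add: vimage_def)
  next
    case False
    then have "Pair v -` (Pair u -` S) = {}" by (auto simp: S_def \<Theta>)
    then show ?thesis by simp
  qed
  have sf: "sigma_finite_measure (lborel \<Otimes>\<^sub>M lborel :: (real \<times> real) measure)"
    unfolding lborel_prod by (rule lborel.sigma_finite_measure_axioms)
  have "emeasure lborel S = emeasure (lborel \<Otimes>\<^sub>M (lborel \<Otimes>\<^sub>M lborel)) S"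
    by (simp add: lborel_prod)
  also have "\<dots> = (\<integral>\<^sup>+u. emeasure (lborel \<Otimes>\<^sub>M lborel) (Pair u -` S) \<partial>lborel)"
    by (rule sigma_finite_measure.emeasure_pair_measure_alt[OF sf S])
  also have "\<dots> = (\<integral>\<^sup>+u. \<integral>\<^sup>+v. emeasure lborel (Pair v -` (Pair u -` S)) \<partial>lborel \<partial>lborel)"
    by (intro nn_integral_cong lborel.emeasure_pair_measure_alt sets_Pair1[OF S])
  also have "\<dots> \<le> (\<integral>\<^sup>+u. \<integral>\<^sup>+v. ennreal (\<delta> / C) * indicator {a2..b2} v * indicator {a1..b1} u
      \<partial>(lborel :: real measure) \<partial>(lborel :: real measure))"
    by (intro nn_integral_mono fibre)
  also have "\<dots> = ennreal (\<delta> / C) * ennreal (b2 - a2) * ennreal (b1 - a1)"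
    using ab by (simp add: nn_integral_multc nn_integral_cmult nn_integral_cmult_indicator)
  also have "\<dots> = ennreal ((b1 - a1) * (b2 - a2) * (\<delta> / C))"
    using ab C \<delta> by (simp add: ennreal_mult[symmetric] mult_ac)
  finally show ?thesis by (simp add: S_def)
qed

lemma emeasure_density_esssup_le:
  assumes f: "f \<in> borel_measurable N" "esssup N f \<le> c" and S: "S \<in> sets N"
  shows "emeasure (density N f) S \<le> c * emeasure N S"
proof -
  have "AE \<theta> in N. f \<theta> * indicator S \<theta> \<le> c * indicator S \<theta>"
    using esssup_AE[of f N] by eventually_elim (use f(2) in \<open>auto split: split_indicator\<close>)
  then have "(\<integral>\<^sup>+\<theta>. f \<theta> * indicator S \<theta> \<partial>N) \<le> (\<integral>\<^sup>+\<theta>. c * indicator S \<theta> \<partial>N)"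
    by (rule nn_integral_mono_AE)
  then show ?thesis using f(1) S by (simp add: emeasure_density nn_integral_cmult_indicator)
qed

section \<open>Certainty equivalents and utilities\<close>

text \<open>Remaining uninsured is the contract \<open>(0, 0, 0)\<close>, so both effort problems are instances of one.\<close>
lemma CE_out_eq: "CE_out x \<mu> lam e \<theta> m = CE_in x \<mu> lam (0, 0, 0) e \<theta> m"
  by (simp add: CE_out_def CE_in_def split: prod.split)

lemma E_out_eq: "E_out x \<mu> lam Emax \<theta> m = E_in x \<mu> lam Emax (0, 0, 0) \<theta> m"
  by (simp add: E_out_def E_in_def CE_out_eq)

lemma E_in_iff:
  "e \<in> E_in x \<mu> lam Emax k \<theta> m \<longleftrightarrow>
     e \<in> {0..Emax} \<and> (\<forall>w\<in>{0..Emax}. CE_in x \<mu> lam k e \<theta> m \<le> CE_in x \<mu> lam k w \<theta> m)"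
  by (auto simp: E_in_def is_arg_min_linorder)

text \<open>The certainty equivalent is a cost: for positive risk aversion the utility is a strictly
  decreasing function of it, so all comparisons reverse.\<close>

lemma U_less_iff:
  assumes "0 < fst \<theta>"
  shows "U_in x \<mu> lam k e \<theta> m < U_out x \<mu> lam e' \<theta> m \<longleftrightarrow>
      CE_in x \<mu> lam (0, 0, 0) e' \<theta> m < CE_in x \<mu> lam k e \<theta> m"
    and "U_out x \<mu> lam e' \<theta> m < U_in x \<mu> lam k e \<theta> m \<longleftrightarrow>
      CE_in x \<mu> lam k e \<theta> m < CE_in x \<mu> lam (0, 0, 0) e' \<theta> m"
  using assms by (auto simp: U_in_def U_out_def CE_out_eq)

section \<open>Optimal efforts and values at a fixed mean effort\<close>

locale insurance_game =
  fixes x Emax pmax \<alpha>min \<alpha>max \<beta>max \<gamma>min \<gamma>max cmax \<sigma>min \<sigma>max L\<mu> Llam Cf :: real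
    and \<mu> lam :: "real \<Rightarrow> real"
    and \<Theta> :: "agent set"
    and \<pi> :: "agent measure"
    and f :: "agent \<Rightarrow> ennreal"
    and K :: "contract set"
  assumes x: "0 \<le> x"
    and K_def: "K = {0..pmax} \<times> {\<alpha>min..\<alpha>max} \<times> {0..\<beta>max}"
    and K_bounds: "0 \<le> pmax" "0 < \<alpha>min" "\<alpha>min \<le> \<alpha>max" "0 \<le> \<beta>max" "\<beta>max < 1"
    and Emax: "0 \<le> Emax"
    and mu: "strictly_convex_on {0..(1 + x) * Emax} \<mu>" "L\<mu>-lipschitz_on {0..(1 + x) * Emax} \<mu>"
    and lam: "strictly_convex_on {0..(1 + x) * Emax} lam" "Llam-lipschitz_on {0..(1 + x) * Emax} lam"
    and \<Theta>_def: "\<Theta> = {\<gamma>min..\<gamma>max} \<times> {0..cmax} \<times> {\<sigma>min..\<sigma>max}"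
    and \<Theta>_bounds: "0 < \<gamma>min" "\<gamma>min < \<gamma>max" "0 < cmax" "0 < \<sigma>min" "\<sigma>min < \<sigma>max"
    and prob: "prob_space \<pi>"
    and density: "f \<in> borel_measurable (restrict_space lborel \<Theta>)"
      "\<pi> = density (restrict_space lborel \<Theta>) f"
      "esssup (restrict_space lborel \<Theta>) f \<le> ennreal Cf"
    and contraction: "(SUP k\<in>K. 3 * x + Emax * C_q x \<gamma>min \<gamma>max cmax \<sigma>min L\<mu> Llam Cf k) < 1"
begin

abbreviation CE :: "contract \<Rightarrow> real \<Rightarrow> agent \<Rightarrow> real \<Rightarrow> real" where
  "CE \<equiv> CE_in x \<mu> lam"

text \<open>Extending the range of \<alpha> down to 0 admits the outside option
  \<open>(0, 0, 0)\<close>, so facts about efforts and values are proved once for both choices.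
  Positivity of \<open>c_sigma\<close> requires \<alpha> > 0 and is therefore stated on
  \<open>K\<close>.\<close>

abbreviation K0 :: "contract set" where
  "K0 \<equiv> {0..pmax} \<times> {0..\<alpha>max} \<times> {0..\<beta>max}"

text \<open>The choice is harmless: on \<open>K0\<close>, \<Theta> and the admissible mean efforts,
  the minimiser exists by \<open>eff_mem_E_in\<close> and is unique by
  \<open>eff_unique\<close>.\<close>

definition eff :: "contract \<Rightarrow> agent \<Rightarrow> real \<Rightarrow> real" where
  "eff k \<theta> m = (SOME e. e \<in> E_in x \<mu> lam Emax k \<theta> m)"

definition val :: "contract \<Rightarrow> agent \<Rightarrow> real \<Rightarrow> real" where
  "val k \<theta> m = CE k (eff k \<theta> m) \<theta> m"

text \<open>Values are minimal costs, so a negative gap means that buying insurance is strictly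
  better and a zero gap is a tie.\<close>

definition gap :: "contract \<Rightarrow> agent \<Rightarrow> real \<Rightarrow> real" where
  "gap k \<theta> m = val k \<theta> m - val (0, 0, 0) \<theta> m"

lemma K_subset: "K \<subseteq> K0"
  using K_bounds by (auto simp: K_def)

lemma outside_in_K0: "(0, 0, 0) \<in> K0"
  using K_bounds by auto

lemma shift_mem: "e \<in> {0..Emax} \<Longrightarrow> m \<in> {0..Emax} \<Longrightarrow> e + x * m \<in> {0..(1 + x) * Emax}"
  using x mult_left_mono[of m Emax x] by (auto simp: algebra_simps intro!: add_mono)

text \<open>Writing the linear term in \<open>y = e + x * m\<close> leaves the correction
  \<open>- (c - \<alpha>) * x * m\<close>, a constant in the effort. A change of \<open>m\<close>
  thus only translates the window over which one fixed convex function is minimised.\<close>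

lemma CE_shift:
  "CE (p, \<alpha>, \<beta>) e (\<gamma>, c, \<sigma>) m =
     (\<lambda>y. (p - (c - \<alpha>) * x * m + 1/2 * \<gamma> * \<alpha>\<^sup>2 * \<sigma>\<^sup>2) + (c - \<alpha>) * y + (1 - \<beta>) * \<mu> y
        + (1/2 * \<gamma> * (1 - \<beta>)\<^sup>2) * lam y) (e + x * m)"
  by (simp add: CE_in_def algebra_simps)

lemma strictly_convex_integrand:
  assumes "(p, \<alpha>, \<beta>) \<in> K0" "(\<gamma>, c, \<sigma>) \<in> \<Theta>"
  shows "strictly_convex_on {0..(1 + x) * Emax}
    (\<lambda>y. d + (c - \<alpha>) * y + (1 - \<beta>) * \<mu> y + (1/2 * \<gamma> * (1 - \<beta>)\<^sup>2) * lam y)"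
  using assms K_bounds \<Theta>_bounds mu lam
  by (intro strictly_convex_on_affine_combination) (auto simp: \<Theta>_def)

lemma strictly_convex_CE:
  assumes "k \<in> K0" "\<theta> \<in> \<Theta>" "m \<in> {0..Emax}"
  shows "strictly_convex_on {0..Emax} (\<lambda>e. CE k e \<theta> m)"
proof -
  obtain p \<alpha> \<beta> where k: "k = (p, \<alpha>, \<beta>)" by (cases k) auto
  obtain \<gamma> c \<sigma> where \<theta>: "\<theta> = (\<gamma>, c, \<sigma>)" by (cases \<theta>) auto
  show ?thesis
    unfolding k \<theta> CE_shift
    by (rule strictly_convex_on_shift[OF strictly_convex_integrand])
      (use assms shift_mem k \<theta> in auto)
qed

lemma continuous_on_mu: "continuous_on {0..(1 + x) * Emax} \<mu>"
  and continuous_on_lam: "continuous_on {0..(1 + x) * Emax} lam"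
  using mu(2) lam(2) by (auto intro: lipschitz_on_continuous_on)

lemma continuous_on_CE:
  "continuous_on ((K0 \<times> \<Theta> \<times> {0..Emax}) \<times> {0..Emax}) (\<lambda>((k, \<theta>, m), e). CE k e \<theta> m)"
  unfolding CE_in_def case_prod_beta
  by (intro continuous_intros continuous_on_compose2[OF continuous_on_mu]
      continuous_on_compose2[OF continuous_on_lam]) (use shift_mem in auto)

lemma eff_mem_E_in:
  assumes "k \<in> K0" "\<theta> \<in> \<Theta>" "m \<in> {0..Emax}"
  shows "eff k \<theta> m \<in> E_in x \<mu> lam Emax k \<theta> m"
proof -
  have "continuous_on {0..Emax} (\<lambda>e. (\<lambda>((k, \<theta>, m), e). CE k e \<theta> m) ((k, \<theta>, m), e))"
    by (intro continuous_on_compose2[OF continuous_on_CE] continuous_intros) (use assms in auto)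
  then obtain e where "e \<in> {0..Emax}" "\<forall>w\<in>{0..Emax}. CE k e \<theta> m \<le> CE k w \<theta> m"
    using continuous_attains_inf[of "{0..Emax}" "\<lambda>e. CE k e \<theta> m"] Emax by auto
  then have "e \<in> E_in x \<mu> lam Emax k \<theta> m" by (simp add: E_in_iff)
  then show ?thesis unfolding eff_def by (rule someI)
qed

lemma eff_unique:
  assumes "k \<in> K0" "\<theta> \<in> \<Theta>" "m \<in> {0..Emax}" "e \<in> E_in x \<mu> lam Emax k \<theta> m"
  shows "e = eff k \<theta> m"
  using strictly_convex_on_unique_min[OF strictly_convex_CE[OF assms(1-3)]]
    assms(4) eff_mem_E_in[OF assms(1-3)] unfolding E_in_iff by blast

lemma eff_bounds:
  assumes "k \<in> K0" "\<theta> \<in> \<Theta>" "m \<in> {0..Emax}"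
  shows "eff k \<theta> m \<in> {0..Emax}"
  using eff_mem_E_in[OF assms] by (simp add: E_in_iff)

lemma val_le:
  assumes "k \<in> K0" "\<theta> \<in> \<Theta>" "m \<in> {0..Emax}" "e \<in> {0..Emax}"
  shows "val k \<theta> m \<le> CE k e \<theta> m"
  using eff_mem_E_in[OF assms(1-3)] assms(4) by (simp add: E_in_iff val_def)

lemma continuous_on_eff: "continuous_on (K0 \<times> \<Theta> \<times> {0..Emax}) (\<lambda>(k, \<theta>, m). eff k \<theta> m)"
proof (rule continuous_on_unique_minimizer[where F = "\<lambda>(k, \<theta>, m) e. CE k e \<theta> m" and T = "{0..Emax}"])
  show "closed (K0 \<times> \<Theta> \<times> {0..Emax})"
    unfolding \<Theta>_def by (intro closed_Times closed_atLeastAtMost)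
  show "continuous_on ((K0 \<times> \<Theta> \<times> {0..Emax}) \<times> {0..Emax})
      (\<lambda>(z, e). (case z of (k, \<theta>, m) \<Rightarrow> \<lambda>e. CE k e \<theta> m) e)"
    using continuous_on_CE by (simp add: case_prod_beta)
  fix z e assume z: "z \<in> K0 \<times> \<Theta> \<times> {0..Emax}"
  obtain k \<theta> m where zz: "z = (k, \<theta>, m)" by (cases z) auto
  show "(case z of (k, \<theta>, m) \<Rightarrow> eff k \<theta> m) \<in> {0..Emax}"
    using eff_bounds z by (auto simp: zz)
  assume e: "e \<in> {0..Emax}"
  show "(case z of (k, \<theta>, m) \<Rightarrow> \<lambda>e. CE k e \<theta> m) (case z of (k, \<theta>, m) \<Rightarrow> eff k \<theta> m)
      \<le> (case z of (k, \<theta>, m) \<Rightarrow> \<lambda>e. CE k e \<theta> m) e"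
    using val_le[of k \<theta> m e] z e by (auto simp: zz val_def)
  assume min: "\<And>w. w \<in> {0..Emax} \<Longrightarrow> (case z of (k, \<theta>, m) \<Rightarrow> \<lambda>e. CE k e \<theta> m) e
      \<le> (case z of (k, \<theta>, m) \<Rightarrow> \<lambda>e. CE k e \<theta> m) w"
  have "e = eff k \<theta> m"
    by (rule eff_unique) (use z e min in \<open>auto simp: zz E_in_iff\<close>)
  then show "e = (case z of (k, \<theta>, m) \<Rightarrow> eff k \<theta> m)" by (simp add: zz)
qed simp

lemma continuous_on_val: "continuous_on (K0 \<times> \<Theta> \<times> {0..Emax}) (\<lambda>(k, \<theta>, m). val k \<theta> m)"
proof -
  have "continuous_on (K0 \<times> \<Theta> \<times> {0..Emax})
      (\<lambda>z. (\<lambda>((k, \<theta>, m), e). CE k e \<theta> m) (z, (\<lambda>(k, \<theta>, m). eff k \<theta> m) z))"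
    by (intro continuous_on_compose2[OF continuous_on_CE] continuous_intros continuous_on_eff)
      (use eff_bounds in auto)
  then show ?thesis by (simp add: val_def case_prod_beta)
qed

lemma continuous_on_gap: "continuous_on (K0 \<times> \<Theta> \<times> {0..Emax}) (\<lambda>(k, \<theta>, m). gap k \<theta> m)"
proof -
  have "continuous_on (K0 \<times> \<Theta> \<times> {0..Emax})
      (\<lambda>z. (\<lambda>(k, \<theta>, m). val k \<theta> m) z - (\<lambda>(k, \<theta>, m). val k \<theta> m) ((0, 0, 0), snd z))"
    by (intro continuous_on_diff continuous_on_val continuous_on_compose2[OF continuous_on_val]
        continuous_intros) (use outside_in_K0 in auto)
  then show ?thesis by (simp add: gap_def case_prod_beta)
qed

section \<open>Dependence of efforts and values on the mean effort and on \<sigma>\<close>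

text \<open>By \<open>shifted_minimizers_mono\<close> a larger mean effort lowers the own effort,
  but not the total \<open>eff k \<theta> m + x * m\<close>; together the two monotonicities bound
  the change.\<close>

lemma eff_lipschitz:
  assumes k: "k \<in> K0" and \<theta>: "\<theta> \<in> \<Theta>" and m: "m \<in> {0..Emax}" "m' \<in> {0..Emax}"
  shows "\<bar>eff k \<theta> m - eff k \<theta> m'\<bar> \<le> x * \<bar>m - m'\<bar>"
proof -
  obtain p \<alpha> \<beta> where kk: "k = (p, \<alpha>, \<beta>)" by (cases k) auto
  obtain \<gamma> c \<sigma> where tt: "\<theta> = (\<gamma>, c, \<sigma>)" by (cases \<theta>) auto
  define g where "g y = 0 + (c - \<alpha>) * y + (1 - \<beta>) * \<mu> y + (1/2 * \<gamma> * (1 - \<beta>)\<^sup>2) * lam y" for y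
  have g: "strictly_convex_on {0..(1 + x) * Emax} g"
    unfolding g_def using strictly_convex_integrand k \<theta> kk tt by blast
  have CE_g: "CE k e \<theta> n = p - (c - \<alpha>) * x * n + 1/2 * \<gamma> * \<alpha>\<^sup>2 * \<sigma>\<^sup>2 + g (e + x * n)" for e n
    unfolding kk tt CE_shift g_def by simp
  have min: "g (eff k \<theta> n + x * n) \<le> g (w + x * n)" if "n \<in> {0..Emax}" "w \<in> {0..Emax}" for n w
    using val_le[OF k \<theta> that] by (simp add: val_def CE_g)
  have sub: "{x * n..x * n + Emax} \<subseteq> {0..(1 + x) * Emax}" if "n \<in> {0..Emax}" for n
    using shift_mem[of Emax n] x that Emax by (auto simp: algebra_simps)
  have *: "\<bar>eff k \<theta> n - eff k \<theta> n'\<bar> \<le> x * \<bar>n - n'\<bar>"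
    if n: "n \<in> {0..Emax}" "n' \<in> {0..Emax}" "n \<le> n'" for n n'
  proof -
    have "eff k \<theta> n' \<le> eff k \<theta> n \<and> eff k \<theta> n + x * n \<le> eff k \<theta> n' + x * n'"
      by (rule shifted_minimizers_mono[OF g sub sub])
        (use n x k \<theta> min eff_bounds in \<open>auto intro: mult_left_mono\<close>)
    then show ?thesis using n by (auto simp: algebra_simps)
  qed
  show ?thesis
    using *[OF m] *[OF m(2) m(1)] by (cases "m \<le> m'") (auto simp: abs_minus_commute)
qed

lemma CE_lipschitz:
  assumes k: "(p, \<alpha>, \<beta>) \<in> K0" and \<theta>: "(\<gamma>, c, \<sigma>) \<in> \<Theta>"
    and m: "m \<in> {0..Emax}" "m' \<in> {0..Emax}" and e: "e \<in> {0..Emax}"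
  shows "\<bar>CE (p, \<alpha>, \<beta>) e (\<gamma>, c, \<sigma>) m - CE (p, \<alpha>, \<beta>) e (\<gamma>, c, \<sigma>) m'\<bar>
    \<le> x * ((1 - \<beta>) * L\<mu> + 1/2 * \<gamma>max * (1 - \<beta>)\<^sup>2 * Llam) * \<bar>m - m'\<bar>"
proof -
  have d: "\<bar>(e + x * m) - (e + x * m')\<bar> = x * \<bar>m - m'\<bar>"
    using x by (simp add: abs_mult right_diff_distrib[symmetric])
  have 1: "\<bar>\<mu> (e + x * m) - \<mu> (e + x * m')\<bar> \<le> L\<mu> * (x * \<bar>m - m'\<bar>)"
    using lipschitz_onD[OF mu(2) shift_mem[OF e m(1)] shift_mem[OF e m(2)]] d by (simp add: dist_real_def)
  have 2: "\<bar>lam (e + x * m) - lam (e + x * m')\<bar> \<le> Llam * (x * \<bar>m - m'\<bar>)"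
    using lipschitz_onD[OF lam(2) shift_mem[OF e m(1)] shift_mem[OF e m(2)]] d by (simp add: dist_real_def)
  have L: "0 \<le> Llam * (x * \<bar>m - m'\<bar>)" using 2 by linarith
  have b: "0 \<le> 1 - \<beta>" using k K_bounds by auto
  have g: "0 \<le> \<gamma>" "\<gamma> \<le> \<gamma>max" using \<theta> \<Theta>_bounds by (auto simp: \<Theta>_def)
  have "\<bar>(1 - \<beta>) * (\<mu> (e + x * m) - \<mu> (e + x * m'))\<bar> \<le> (1 - \<beta>) * (L\<mu> * (x * \<bar>m - m'\<bar>))"
    using 1 b by (simp add: abs_mult mult_left_mono)
  moreover have "\<bar>1/2 * \<gamma> * (1 - \<beta>)\<^sup>2 * (lam (e + x * m) - lam (e + x * m'))\<bar>
      \<le> 1/2 * \<gamma>max * (1 - \<beta>)\<^sup>2 * (Llam * (x * \<bar>m - m'\<bar>))"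
    unfolding abs_mult using 2 g L by (intro mult_mono) auto
  ultimately have "\<bar>(1 - \<beta>) * (\<mu> (e + x * m) - \<mu> (e + x * m'))
        + 1/2 * \<gamma> * (1 - \<beta>)\<^sup>2 * (lam (e + x * m) - lam (e + x * m'))\<bar>
      \<le> (1 - \<beta>) * (L\<mu> * (x * \<bar>m - m'\<bar>)) + 1/2 * \<gamma>max * (1 - \<beta>)\<^sup>2 * (Llam * (x * \<bar>m - m'\<bar>))"
    by linarith
  then show ?thesis by (simp add: CE_in_def algebra_simps diff_divide_distrib)
qed

text \<open>The value at either mean effort is at most the cost of the effort that is optimal at the
  other one. The difference of values is therefore controlled by cost differences at a fixed effort,
  without differentiating anything.\<close>

lemma val_lipschitz:
  assumes k: "(p, \<alpha>, \<beta>) \<in> K0" and \<theta>: "\<theta> \<in> \<Theta>" and m: "m \<in> {0..Emax}" "m' \<in> {0..Emax}"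
  shows "\<bar>val (p, \<alpha>, \<beta>) \<theta> m - val (p, \<alpha>, \<beta>) \<theta> m'\<bar>
    \<le> x * ((1 - \<beta>) * L\<mu> + 1/2 * \<gamma>max * (1 - \<beta>)\<^sup>2 * Llam) * \<bar>m - m'\<bar>"
proof -
  obtain \<gamma> c \<sigma> where tt: "\<theta> = (\<gamma>, c, \<sigma>)" by (cases \<theta>) auto
  show ?thesis
    using CE_lipschitz[OF k \<theta>[unfolded tt] m eff_bounds[OF k \<theta> m(1)]]
      CE_lipschitz[OF k \<theta>[unfolded tt] m eff_bounds[OF k \<theta> m(2)]]
      val_le[OF k \<theta> m(1) eff_bounds[OF k \<theta> m(2)]] val_le[OF k \<theta> m(2) eff_bounds[OF k \<theta> m(1)]]
    unfolding val_def tt by linarith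
qed

lemma gap_lipschitz:
  assumes k: "k \<in> K" and \<theta>: "\<theta> \<in> \<Theta>" and m: "m \<in> {0..Emax}" "m' \<in> {0..Emax}"
  shows "\<bar>gap k \<theta> m - gap k \<theta> m'\<bar> \<le> C_m x \<gamma>max cmax L\<mu> Llam k * \<bar>m - m'\<bar>"
proof -
  obtain p \<alpha> \<beta> where kk: "k = (p, \<alpha>, \<beta>)" by (cases k) auto
  have k0: "(p, \<alpha>, \<beta>) \<in> K0" using k K_subset kk by auto
  let ?A = "(1 - \<beta>) * L\<mu> + 1/2 * \<gamma>max * (1 - \<beta>)\<^sup>2 * Llam"
  let ?B = "L\<mu> + 1/2 * \<gamma>max * Llam"
  have "\<bar>gap k \<theta> m - gap k \<theta> m'\<bar> \<le> x * ?A * \<bar>m - m'\<bar> + x * ?B * \<bar>m - m'\<bar>"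
    using val_lipschitz[OF k0 \<theta> m] val_lipschitz[OF outside_in_K0 \<theta> m]
    unfolding gap_def kk by simp
  also have "\<dots> = x * (?A + ?B) * \<bar>m - m'\<bar>" by (simp add: algebra_simps)
  \<comment> \<open>The nonnegative summand \<open>2 * cmax + \<alpha>\<close> is inserted to reach
    the form of \<open>C_m\<close>.\<close>
  also have "\<dots> \<le> x * (2 * cmax + \<alpha> + (?A + ?B)) * \<bar>m - m'\<bar>"
    using x \<Theta>_bounds k0 by (intro mult_right_mono mult_left_mono) auto
  also have "\<dots> = C_m x \<gamma>max cmax L\<mu> Llam k * \<bar>m - m'\<bar>"
    by (simp add: C_m_def kk algebra_simps)
  finally show ?thesis .
qed

text \<open>The term containing \<sigma> is independent of the effort, so it passes unchanged
  through the minimum.\<close>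

lemma val_sigma:
  assumes k: "(p, \<alpha>, \<beta>) \<in> K0" and \<theta>: "(\<gamma>, c, \<sigma>) \<in> \<Theta>" "(\<gamma>, c, \<sigma>') \<in> \<Theta>" and m: "m \<in> {0..Emax}"
  shows "val (p, \<alpha>, \<beta>) (\<gamma>, c, \<sigma>') m - val (p, \<alpha>, \<beta>) (\<gamma>, c, \<sigma>) m
    = 1/2 * \<gamma> * \<alpha>\<^sup>2 * (\<sigma>'\<^sup>2 - \<sigma>\<^sup>2)"
proof -
  have CE: "CE (p, \<alpha>, \<beta>) e (\<gamma>, c, \<sigma>') m - CE (p, \<alpha>, \<beta>) e (\<gamma>, c, \<sigma>) m
      = 1/2 * \<gamma> * \<alpha>\<^sup>2 * (\<sigma>'\<^sup>2 - \<sigma>\<^sup>2)" for e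
    by (simp add: CE_in_def algebra_simps)
  show ?thesis
    using val_le[OF k \<theta>(1) m eff_bounds[OF k \<theta>(2) m]] val_le[OF k \<theta>(2) m eff_bounds[OF k \<theta>(1) m]]
      CE[of "eff (p, \<alpha>, \<beta>) (\<gamma>, c, \<sigma>) m"] CE[of "eff (p, \<alpha>, \<beta>) (\<gamma>, c, \<sigma>') m"]
    unfolding val_def by linarith
qed

lemma gap_slope:
  assumes k: "k \<in> K" and \<theta>: "(\<gamma>, c, \<sigma>) \<in> \<Theta>" "(\<gamma>, c, \<sigma>') \<in> \<Theta>" and less: "\<sigma> < \<sigma>'"
    and m: "m \<in> {0..Emax}"
  shows "c_sigma \<gamma>min \<sigma>min k * (\<sigma>' - \<sigma>) \<le> gap k (\<gamma>, c, \<sigma>') m - gap k (\<gamma>, c, \<sigma>) m"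
proof -
  obtain p \<alpha> \<beta> where kk: "k = (p, \<alpha>, \<beta>)" by (cases k) auto
  have k0: "(p, \<alpha>, \<beta>) \<in> K0" using k K_subset kk by auto
  \<comment> \<open>The outside value has \<alpha> = 0 and is constant in \<sigma>. After factoring
    the difference of squares, the mean of \<sigma> and \<sigma>' is bounded below by
    \<open>\<sigma>min\<close>.\<close>
  have "gap k (\<gamma>, c, \<sigma>') m - gap k (\<gamma>, c, \<sigma>) m = 1/2 * \<gamma> * \<alpha>\<^sup>2 * (\<sigma>'\<^sup>2 - \<sigma>\<^sup>2)"
    using val_sigma[OF k0 \<theta> m] val_sigma[OF outside_in_K0 \<theta> m] by (simp add: gap_def kk)
  also have "\<dots> = \<gamma> * \<alpha>\<^sup>2 * ((\<sigma> + \<sigma>') / 2) * (\<sigma>' - \<sigma>)"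
    by (simp add: power2_eq_square algebra_simps)
  also have "\<dots> \<ge> \<gamma>min * \<alpha>\<^sup>2 * \<sigma>min * (\<sigma>' - \<sigma>)"
    using \<theta> less \<Theta>_bounds by (intro mult_mono) (auto simp: \<Theta>_def)
  finally show ?thesis by (simp add: c_sigma_def kk)
qed

section \<open>The type distribution and the contraction constant\<close>

abbreviation Cq :: "contract \<Rightarrow> real" where
  "Cq \<equiv> C_q x \<gamma>min \<gamma>max cmax \<sigma>min L\<mu> Llam Cf"

lemma space_pi [simp]: "space \<pi> = \<Theta>"
  by (simp add: density(2) space_restrict_space)

lemma sets_pi: "sets \<pi> = sets (restrict_space borel \<Theta>)"
  unfolding density(2) sets_density by (intro sets_restrict_space_cong) simp

lemma measurable_pi_continuous:
  fixes g :: "agent \<Rightarrow> real"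
  assumes "continuous_on \<Theta> g" shows "g \<in> borel_measurable \<pi>"
  using borel_measurable_continuous_on_restrict[OF assms] measurable_cong_sets[OF sets_pi refl] by blast

lemma continuous_on_section:
  assumes "continuous_on (A \<times> \<Theta> \<times> {0..Emax}) (\<lambda>(k, \<theta>, m). g k \<theta> m)" "k \<in> A" "m \<in> {0..Emax}"
  shows "continuous_on \<Theta> (\<lambda>\<theta>. g k \<theta> m)"
proof -
  have "continuous_on \<Theta> (\<lambda>\<theta>. (\<lambda>(k, \<theta>, m). g k \<theta> m) (k, \<theta>, m))"
    by (intro continuous_on_compose2[OF assms(1)] continuous_intros) (use assms in auto)
  then show ?thesis by simp
qed

lemma compact_Theta: "compact \<Theta>"
  unfolding \<Theta>_def by (intro compact_Times compact_Icc)

lemma Theta_borel: "\<Theta> \<in> sets borel"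
  using compact_Theta by (intro borel_closed compact_imp_closed)

lemma sets_pi_I: "S \<subseteq> \<Theta> \<Longrightarrow> S \<in> sets borel \<Longrightarrow> S \<in> sets \<pi>"
  unfolding sets_pi using Theta_borel by (simp add: sets_restrict_space_iff)

lemma emeasure_pi_le:
  assumes "S \<subseteq> \<Theta>" "S \<in> sets borel"
  shows "emeasure \<pi> S \<le> ennreal Cf * emeasure lborel S"
proof -
  have "emeasure \<pi> S \<le> ennreal Cf * emeasure (restrict_space lborel \<Theta>) S"
    unfolding density(2) using assms Theta_borel
    by (intro emeasure_density_esssup_le[OF density(1,3)]) (simp add: sets_restrict_space_iff)
  also have "emeasure (restrict_space lborel \<Theta>) S = emeasure lborel S"
    using assms Theta_borel by (intro emeasure_restrict_space) auto
  finally show ?thesis .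
qed

lemma measure_Theta [simp]: "measure \<pi> \<Theta> = 1"
  using prob_space.prob_space[OF prob] by simp

text \<open>The coercion \<open>ennreal\<close> sends negative reals to 0, so the sign of the
  density bound has to be recovered from the total mass 1.\<close>

lemma Cf_pos: "0 < Cf"
proof (rule ccontr)
  assume "\<not> 0 < Cf"
  then have "ennreal Cf = 0" by (simp add: ennreal_neg)
  then have "emeasure \<pi> (space \<pi>) = 0" using emeasure_pi_le[of \<Theta>] Theta_borel by simp
  then show False using prob_space.emeasure_space_1[OF prob] by simp
qed

lemma c_sigma_pos: "k \<in> K \<Longrightarrow> 0 < c_sigma \<gamma>min \<sigma>min k"
  using K_bounds \<Theta>_bounds by (auto simp: c_sigma_def K_def)

lemma lipschitz_consts_nonneg: "0 \<le> L\<mu>" "0 \<le> Llam"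
  using mu(2) lam(2) by (auto intro: lipschitz_on_nonneg)

lemma C_m_nonneg: "k \<in> K \<Longrightarrow> 0 \<le> C_m x \<gamma>max cmax L\<mu> Llam k"
  using x K_bounds \<Theta>_bounds lipschitz_consts_nonneg
  by (auto simp: C_m_def K_def intro!: mult_nonneg_nonneg add_nonneg_nonneg)

lemma Cq_nonneg: "k \<in> K \<Longrightarrow> 0 \<le> Cq k"
  using c_sigma_pos C_m_nonneg Cf_pos \<Theta>_bounds by (simp add: C_q_def less_imp_le)

lemma compact_K: "compact K"
  unfolding K_def by (intro compact_Times compact_Icc)

lemma K_nonempty: "K \<noteq> {}"
  using K_bounds by (auto simp: K_def)

lemma contraction_const:
  assumes "k \<in> K" shows "x + Emax * Cq k < 1"
proof -
  \<comment> \<open>A real supremum dominates the members of its set only if the set is bounded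
    above; continuity of the constant on the compact set \<open>K\<close> supplies this.\<close>
  have "continuous_on K (\<lambda>k. 3 * x + Emax * Cq k)"
    using c_sigma_pos unfolding C_q_def c_sigma_def C_m_def case_prod_beta
    by (intro continuous_intros) (auto dest!: c_sigma_pos simp: c_sigma_def)
  then have "bdd_above ((\<lambda>k. 3 * x + Emax * Cq k) ` K)"
    using compact_K by (intro bounded_imp_bdd_above compact_imp_bounded compact_continuous_image)
  then have "3 * x + Emax * Cq k < 1"
    using cSUP_upper[OF assms] contraction by (meson le_less_trans)
  then show ?thesis using x by simp
qed

lemma continuous_on_gap_section:
  assumes "k \<in> K" "m \<in> {0..Emax}"
  shows "continuous_on \<Theta> (\<lambda>\<theta>. gap k \<theta> m)"
  by (rule continuous_on_section[OF continuous_on_gap]) (use assms K_subset in auto)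

section \<open>Mass of the types whose decision changes\<close>

lemma sets_sign_change:
  assumes "k \<in> K" "m \<in> {0..Emax}" "m' \<in> {0..Emax}"
  shows "{\<theta>\<in>\<Theta>. gap k \<theta> m * gap k \<theta> m' \<le> 0} \<in> sets borel"
  using assms compact_Theta
  by (intro borel_closed continuous_on_closed_Collect_le continuous_intros continuous_on_gap_section
      compact_imp_closed)

text \<open>The fibre bound with slope \<open>c_sigma\<close> and distance \<open>C_m\<close> times
  the change of mean effort, multiplied by the area of the \<gamma>-\<open>c\<close> rectangle and
  by the density bound, is exactly the constant \<open>Cq\<close>.\<close>

lemma sign_change_measure:
  assumes k: "k \<in> K" and m: "m \<in> {0..Emax}" "m' \<in> {0..Emax}"
  shows "measure \<pi> {\<theta>\<in>\<Theta>. gap k \<theta> m * gap k \<theta> m' \<le> 0} \<le> Cq k * \<bar>m - m'\<bar>"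
proof -
  let ?S = "{\<theta>\<in>\<Theta>. gap k \<theta> m * gap k \<theta> m' \<le> 0}" and ?c = "c_sigma \<gamma>min \<sigma>min k"
  let ?d = "C_m x \<gamma>max cmax L\<mu> Llam k * \<bar>m - m'\<bar>"
  have "emeasure lborel ?S \<le> ennreal ((\<gamma>max - \<gamma>min) * (cmax - 0) * (?d / ?c))"
    using \<Theta>_bounds gap_slope[OF k] gap_lipschitz[OF k] m continuous_on_gap_section[OF k]
      c_sigma_pos[OF k] C_m_nonneg[OF k]
    by (intro emeasure_sign_change_le[OF \<Theta>_def]) auto
  then have "ennreal Cf * emeasure lborel ?S
      \<le> ennreal Cf * ennreal ((\<gamma>max - \<gamma>min) * (cmax - 0) * (?d / ?c))"
    by (intro mult_left_mono) auto
  then have "emeasure \<pi> ?S \<le> ennreal Cf * ennreal ((\<gamma>max - \<gamma>min) * (cmax - 0) * (?d / ?c))"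
    using emeasure_pi_le[of ?S] sets_sign_change[OF k m] by (auto intro: order_trans)
  also have "\<dots> = ennreal (Cf * ((\<gamma>max - \<gamma>min) * cmax * (?d / ?c)))"
    using Cf_pos by (subst ennreal_mult'[symmetric]) auto
  also have "Cf * ((\<gamma>max - \<gamma>min) * cmax * (?d / ?c)) = Cq k * \<bar>m - m'\<bar>"
    by (simp add: C_q_def)
  finally have "emeasure \<pi> ?S \<le> ennreal (Cq k * \<bar>m - m'\<bar>)" .
  then show ?thesis
    using Cq_nonneg[OF k] unfolding measure_def by (intro enn2real_leI) auto
qed

text \<open>Taking \<open>m' = m\<close> in \<open>sign_change_measure\<close> makes the set equal
  to the set of ties and the bound equal to 0.\<close>

lemma AE_gap_nonzero:
  assumes k: "k \<in> K" and m: "m \<in> {0..Emax}"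
  shows "AE \<theta> in \<pi>. gap k \<theta> m \<noteq> 0"
proof -
  interpret prob_space \<pi> by (rule prob)
  let ?S = "{\<theta>\<in>\<Theta>. gap k \<theta> m * gap k \<theta> m \<le> 0}"
  have "?S \<in> sets \<pi>"
    by (intro sets_pi_I sets_sign_change[OF k m m]) blast
  moreover have "measure \<pi> ?S = 0"
    using sign_change_measure[OF k m m] by (simp add: measure_le_0_iff)
  ultimately have "?S \<in> null_sets \<pi>" by (simp add: null_sets_def emeasure_eq_measure)
  then show ?thesis by (rule AE_I') (auto simp: mult_le_0_iff)
qed

section \<open>Integrals of quantities that jump with the decision\<close>

text \<open>Generic in the two branches so that it serves both the mean effort and the profit. Ties
  go to the outside branch, a convention that affects only a null set.\<close>

definition switch :: "(contract \<Rightarrow> agent \<Rightarrow> real \<Rightarrow> real) \<Rightarrow> (contract \<Rightarrow> agent \<Rightarrow> real \<Rightarrow> real) \<Rightarrow>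
    contract \<Rightarrow> real \<Rightarrow> agent \<Rightarrow> real" where
  "switch g h k m \<theta> = (if gap k \<theta> m < 0 then g k \<theta> m else h k \<theta> m)"

lemma switch_measurable:
  assumes "continuous_on (K \<times> \<Theta> \<times> {0..Emax}) (\<lambda>(k, \<theta>, m). g k \<theta> m)"
    "continuous_on (K \<times> \<Theta> \<times> {0..Emax}) (\<lambda>(k, \<theta>, m). h k \<theta> m)" "k \<in> K" "m \<in> {0..Emax}"
  shows "switch g h k m \<in> borel_measurable \<pi>"
proof -
  have [measurable]: "(\<lambda>\<theta>. g k \<theta> m) \<in> borel_measurable \<pi>" "(\<lambda>\<theta>. h k \<theta> m) \<in> borel_measurable \<pi>"
    "(\<lambda>\<theta>. gap k \<theta> m) \<in> borel_measurable \<pi>"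
    using assms continuous_on_section continuous_on_gap_section by (blast intro: measurable_pi_continuous)+
  show ?thesis unfolding switch_def[abs_def] by measurable
qed

text \<open>The integrand is discontinuous only at ties. Elsewhere the sign of the gap is eventually
  that of its limit, so the branch is eventually fixed and converges. Compactness bounds both
  branches, giving a constant dominating function.\<close>

lemma continuous_on_integral_switch:
  assumes g: "continuous_on (K \<times> \<Theta> \<times> {0..Emax}) (\<lambda>(k, \<theta>, m). g k \<theta> m)"
    and h: "continuous_on (K \<times> \<Theta> \<times> {0..Emax}) (\<lambda>(k, \<theta>, m). h k \<theta> m)"
  shows "continuous_on (K \<times> {0..Emax}) (\<lambda>(k, m). \<integral>\<theta>. switch g h k m \<theta> \<partial>\<pi>)"
  unfolding continuous_on_sequentially
proof (intro allI ballI impI)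
  interpret prob_space \<pi> by (rule prob)
  fix u a assume a: "a \<in> K \<times> {0..Emax}" and u: "(\<forall>n. u n \<in> K \<times> {0..Emax}) \<and> u \<longlonglongrightarrow> a"
  obtain k m where km: "a = (k, m)" "k \<in> K" "m \<in> {0..Emax}" using a by (cases a) auto
  define kn where "kn n = fst (u n)" for n
  define mn where "mn n = snd (u n)" for n
  have un: "u n = (kn n, mn n)" "kn n \<in> K" "mn n \<in> {0..Emax}" for n
    using u by (auto simp: kn_def mn_def mem_Times_iff)
  have lims: "kn \<longlonglongrightarrow> k" "mn \<longlonglongrightarrow> m"
    using u tendsto_fst[of u a] tendsto_snd[of u a] by (auto simp: km(1) kn_def[abs_def] mn_def[abs_def])
  have lim: "(\<lambda>n. w (kn n) \<theta> (mn n)) \<longlonglongrightarrow> w k \<theta> m"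
    if w: "continuous_on (K \<times> \<Theta> \<times> {0..Emax}) (\<lambda>(k, \<theta>, m). w k \<theta> m)" and \<theta>: "\<theta> \<in> \<Theta>"
    for w :: "contract \<Rightarrow> agent \<Rightarrow> real \<Rightarrow> real" and \<theta>
  proof -
    have "(\<lambda>n. (\<lambda>(k, \<theta>, m). w k \<theta> m) (kn n, \<theta>, mn n)) \<longlonglongrightarrow> (\<lambda>(k, \<theta>, m). w k \<theta> m) (k, \<theta>, m)"
      by (rule continuous_on_tendsto_compose[OF w])
        (use un km \<theta> lims in \<open>auto intro!: tendsto_Pair\<close>)
    then show ?thesis by simp
  qed
  have gap: "continuous_on (K \<times> \<Theta> \<times> {0..Emax}) (\<lambda>(k, \<theta>, m). gap k \<theta> m)"
    by (rule continuous_on_subset[OF continuous_on_gap]) (use K_subset in auto)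
  have "\<exists>B. \<forall>z\<in>K \<times> \<Theta> \<times> {0..Emax}. norm (w z) \<le> B"
    if "continuous_on (K \<times> \<Theta> \<times> {0..Emax}) w" for w :: "contract \<times> agent \<times> real \<Rightarrow> real"
    using compact_imp_bounded[OF compact_continuous_image[OF that]] compact_K compact_Theta
    by (auto simp: bounded_iff compact_Times)
  from this[OF g] this[OF h] obtain B C
    where B: "\<And>k \<theta> m. k \<in> K \<Longrightarrow> \<theta> \<in> \<Theta> \<Longrightarrow> m \<in> {0..Emax} \<Longrightarrow> \<bar>g k \<theta> m\<bar> \<le> B"
      and C: "\<And>k \<theta> m. k \<in> K \<Longrightarrow> \<theta> \<in> \<Theta> \<Longrightarrow> m \<in> {0..Emax} \<Longrightarrow> \<bar>h k \<theta> m\<bar> \<le> C"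
    by fastforce
  have "(\<lambda>n. \<integral>\<theta>. switch g h (kn n) (mn n) \<theta> \<partial>\<pi>) \<longlonglongrightarrow> (\<integral>\<theta>. switch g h k m \<theta> \<partial>\<pi>)"
  proof (rule integral_dominated_convergence[where w = "\<lambda>_. max B C"])
    show "AE \<theta> in \<pi>. (\<lambda>n. switch g h (kn n) (mn n) \<theta>) \<longlonglongrightarrow> switch g h k m \<theta>"
      using AE_gap_nonzero[OF km(2,3)] AE_space
    proof eventually_elim
      case (elim \<theta>)
      then have \<theta>: "\<theta> \<in> \<Theta>" by simp
      show ?case
      proof (cases "gap k \<theta> m < 0")
        case True
        have "\<forall>\<^sub>F n in sequentially. gap (kn n) \<theta> (mn n) < 0"
          using order_tendstoD(2)[OF lim[OF gap \<theta>] True] .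
        then have "\<forall>\<^sub>F n in sequentially. g (kn n) \<theta> (mn n) = switch g h (kn n) (mn n) \<theta>"
          by eventually_elim (simp add: switch_def)
        then show ?thesis
          using Lim_transform_eventually[OF lim[OF g \<theta>]] True by (simp add: switch_def)
      next
        case False
        then have "0 < gap k \<theta> m" using elim by simp
        from order_tendstoD(1)[OF lim[OF gap \<theta>] this]
        have "\<forall>\<^sub>F n in sequentially. h (kn n) \<theta> (mn n) = switch g h (kn n) (mn n) \<theta>"
          by eventually_elim (simp add: switch_def)
        then show ?thesis
          using Lim_transform_eventually[OF lim[OF h \<theta>]] False by (simp add: switch_def)
      qed
    qed
    show "AE \<theta> in \<pi>. norm (switch g h (kn n) (mn n) \<theta>) \<le> max B C" for n
      using AE_space
    proof eventually_elim
      case (elim \<theta>)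
      then show ?case
        using B[OF un(2) _ un(3), of \<theta> n n] C[OF un(2) _ un(3), of \<theta> n n] by (simp add: switch_def le_max_iff_disj)
    qed
  qed (use switch_measurable[OF g h] km un in auto)
  then show "((\<lambda>(k, m). \<integral>\<theta>. switch g h k m \<theta> \<partial>\<pi>) \<circ> u) \<longlonglongrightarrow>
      (\<lambda>(k, m). \<integral>\<theta>. switch g h k m \<theta> \<partial>\<pi>) a"
    by (simp add: o_def un(1) km(1))
qed

section \<open>The mean response and its fixed point\<close>

definition response :: "contract \<Rightarrow> real \<Rightarrow> real" where
  "response k m = (\<integral>\<theta>. switch eff (\<lambda>_. eff (0, 0, 0)) k m \<theta> \<partial>\<pi>)"

lemma continuous_on_eff_in: "continuous_on (K \<times> \<Theta> \<times> {0..Emax}) (\<lambda>(k, \<theta>, m). eff k \<theta> m)"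
  by (rule continuous_on_subset[OF continuous_on_eff]) (use K_subset in auto)

lemma continuous_on_eff_out:
  "continuous_on (K \<times> \<Theta> \<times> {0..Emax}) (\<lambda>(k, \<theta>, m). eff (0, 0, 0) \<theta> m)"
proof -
  have "continuous_on (K \<times> \<Theta> \<times> {0..Emax}) (\<lambda>z. (\<lambda>(k, \<theta>, m). eff k \<theta> m) ((0, 0, 0), snd z))"
    by (intro continuous_on_compose2[OF continuous_on_eff] continuous_intros)
      (use outside_in_K0 in auto)
  then show ?thesis by (simp add: case_prod_beta)
qed

lemmas response_measurable = switch_measurable[OF continuous_on_eff_in continuous_on_eff_out]

lemma switch_eff_bounds:
  assumes "k \<in> K" "\<theta> \<in> \<Theta>" "m \<in> {0..Emax}"
  shows "switch eff (\<lambda>_. eff (0, 0, 0)) k m \<theta> \<in> {0..Emax}"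
  using eff_bounds[OF outside_in_K0 assms(2,3)] eff_bounds[OF _ assms(2,3), of k] assms(1) K_subset
  by (auto simp: switch_def)

lemma response_integrable:
  assumes "k \<in> K" "m \<in> {0..Emax}"
  shows "integrable \<pi> (switch eff (\<lambda>_. eff (0, 0, 0)) k m)"
proof -
  interpret prob_space \<pi> by (rule prob)
  show ?thesis
  proof (rule integrable_const_bound[where B = Emax])
    show "AE \<theta> in \<pi>. norm (switch eff (\<lambda>_. eff (0, 0, 0)) k m \<theta>) \<le> Emax"
      using AE_space by eventually_elim (use switch_eff_bounds[OF assms(1) _ assms(2)] in force)
  qed (rule response_measurable[OF assms])
qed

lemma response_bounds:
  assumes "k \<in> K" "m \<in> {0..Emax}"
  shows "response k m \<in> {0..Emax}"
proof -
  interpret prob_space \<pi> by (rule prob)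
  have "(\<integral>\<theta>. switch eff (\<lambda>_. eff (0, 0, 0)) k m \<theta> \<partial>\<pi>) \<le> (\<integral>\<theta>. Emax \<partial>\<pi>)"
    using assms switch_eff_bounds by (intro integral_mono response_integrable) auto
  moreover have "0 \<le> (\<integral>\<theta>. switch eff (\<lambda>_. eff (0, 0, 0)) k m \<theta> \<partial>\<pi>)"
    using assms switch_eff_bounds by (intro Bochner_Integration.integral_nonneg) auto
  ultimately show ?thesis by (simp add: response_def)
qed

lemma response_contraction:
  assumes k: "k \<in> K" and m: "m \<in> {0..Emax}" "m' \<in> {0..Emax}"
  shows "\<bar>response k m - response k m'\<bar> \<le> (x + Emax * Cq k) * \<bar>m - m'\<bar>"
proof -
  interpret prob_space \<pi> by (rule prob)
  let ?S = "{\<theta>\<in>\<Theta>. gap k \<theta> m * gap k \<theta> m' \<le> 0}"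
  let ?r = "switch eff (\<lambda>_. eff (0, 0, 0)) k"
  have S: "?S \<in> sets \<pi>"
    by (intro sets_pi_I sets_sign_change[OF k m]) blast
  have k0: "k \<in> K0" using k K_subset by auto
  \<comment> \<open>Types outside \<open>?S\<close> keep their decision and move by the Lipschitz
    bound for that branch. The others may jump between branches, by at most the length
    \<open>Emax\<close> of the effort range.\<close>
  have pt: "\<bar>?r m \<theta> - ?r m' \<theta>\<bar> \<le> x * \<bar>m - m'\<bar> + Emax * indicator ?S \<theta>" if \<theta>: "\<theta> \<in> \<Theta>" for \<theta>
  proof (cases "\<theta> \<in> ?S")
    case True
    have "0 \<le> x * \<bar>m - m'\<bar>" using x by simp
    then show ?thesis
      using True switch_eff_bounds[OF k \<theta> m(1)] switch_eff_bounds[OF k \<theta> m(2)] by auto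
  next
    case False
    then have "gap k \<theta> m < 0 \<longleftrightarrow> gap k \<theta> m' < 0"
      using \<theta> by (auto simp: mult_le_0_iff not_less not_le)
    then show ?thesis
      using False eff_lipschitz[OF k0 \<theta> m] eff_lipschitz[OF outside_in_K0 \<theta> m]
      by (auto simp: switch_def)
  qed
  have int: "integrable \<pi> (\<lambda>\<theta>. x * \<bar>m - m'\<bar> + Emax * indicator ?S \<theta>)"
    using S by (auto simp: emeasure_eq_measure)
  have "\<bar>response k m - response k m'\<bar> = \<bar>\<integral>\<theta>. ?r m \<theta> - ?r m' \<theta> \<partial>\<pi>\<bar>"
    unfolding response_def using k m by (simp add: response_integrable)
  also have "\<dots> \<le> (\<integral>\<theta>. \<bar>?r m \<theta> - ?r m' \<theta>\<bar> \<partial>\<pi>)"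
    by (rule integral_abs_bound)
  also have "\<dots> \<le> (\<integral>\<theta>. x * \<bar>m - m'\<bar> + Emax * indicator ?S \<theta> \<partial>\<pi>)"
    using k m pt by (intro integral_mono integrable_abs Bochner_Integration.integrable_diff
        response_integrable int) auto
  also have "\<dots> = x * \<bar>m - m'\<bar> + Emax * measure \<pi> ?S"
    using S by (simp add: emeasure_eq_measure Int_absorb2)
  also have "\<dots> \<le> x * \<bar>m - m'\<bar> + Emax * (Cq k * \<bar>m - m'\<bar>)"
    using sign_change_measure[OF k m] Emax by (intro add_left_mono mult_left_mono) auto
  finally show ?thesis by (simp add: algebra_simps)
qed

lemma ex1_fixed_point:
  assumes "k \<in> K" shows "\<exists>!m\<in>{0..Emax}. response k m = m"
proof (rule Banach_fix)
  show "{0..Emax} \<noteq> {}" using Emax by simp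
  show "0 \<le> x + Emax * Cq k" using x Emax Cq_nonneg[OF assms] by simp
  show "x + Emax * Cq k < 1" by (rule contraction_const[OF assms])
  show "response k ` {0..Emax} \<subseteq> {0..Emax}" using response_bounds[OF assms] by blast
qed (use response_contraction[OF assms] in \<open>auto simp: dist_real_def intro: compact_imp_complete\<close>)

definition meq :: "contract \<Rightarrow> real" where
  "meq k = (THE m. m \<in> {0..Emax} \<and> response k m = m)"

lemma meq:
  assumes "k \<in> K"
  shows "meq k \<in> {0..Emax}" "response k (meq k) = meq k"
  using theI'[OF ex1_fixed_point[OF assms]] by (auto simp: meq_def)

lemma meq_unique: "k \<in> K \<Longrightarrow> m \<in> {0..Emax} \<Longrightarrow> response k m = m \<Longrightarrow> m = meq k"
  using ex1_fixed_point meq by blast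

text \<open>By uniqueness of the fixed point the graph is the zero set of the jointly continuous
  function \<open>response k m - m\<close>, hence closed, with values in a compact interval.\<close>

lemma continuous_on_meq: "continuous_on K meq"
proof (rule continuous_from_closed_graph[of "{0..Emax}"])
  show "meq \<in> K \<rightarrow> {0..Emax}" using meq by auto
  have cont: "continuous_on (K \<times> {0..Emax}) (\<lambda>z. response (fst z) (snd z) - snd z)"
    using continuous_on_integral_switch[OF continuous_on_eff_in continuous_on_eff_out]
    unfolding response_def case_prod_beta by (intro continuous_intros)
  have "(\<lambda>k. (k, meq k)) ` K = {z \<in> K \<times> {0..Emax}. response (fst z) (snd z) - snd z = 0}"
    using meq meq_unique by (auto simp: image_iff)
  also have "closed \<dots>"
    using cont by (rule continuous_closed_preimage_constant)
      (intro closed_Times closed_atLeastAtMost compact_imp_closed compact_K)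
  finally show "closed ((\<lambda>k. (k, meq k)) ` K)" .
qed simp

section \<open>The profit as a function of the contract\<close>

definition margin :: "contract \<Rightarrow> agent \<Rightarrow> real \<Rightarrow> real" where
  "margin k \<theta> m = fst k - fst (snd k) * eff k \<theta> m - snd (snd k) * \<mu> (eff k \<theta> m + x * m)"

text \<open>Expressed through \<open>eff\<close>, \<open>gap\<close> and \<open>meq\<close> only, so
  that continuity can be proved without choosing an equilibrium.\<close>

definition profit :: "contract \<Rightarrow> real" where
  "profit k = (\<integral>\<theta>. switch margin (\<lambda>_ _ _. 0) k (meq k) \<theta> \<partial>\<pi>)"

lemma continuous_on_margin: "continuous_on (K \<times> \<Theta> \<times> {0..Emax}) (\<lambda>(k, \<theta>, m). margin k \<theta> m)"
proof -
  have e: "continuous_on (K \<times> \<Theta> \<times> {0..Emax}) (\<lambda>z. eff (fst z) (fst (snd z)) (snd (snd z)))"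
    using continuous_on_eff_in by (simp add: case_prod_beta)
  show ?thesis
    unfolding margin_def case_prod_beta
    by (intro continuous_intros continuous_on_compose2[OF continuous_on_mu] e)
      (use eff_bounds shift_mem K_subset in auto)
qed

lemma continuous_on_profit: "continuous_on K profit"
proof -
  have "continuous_on K (\<lambda>k. (\<lambda>(k, m). \<integral>\<theta>. switch margin (\<lambda>_ _ _. 0) k m \<theta> \<partial>\<pi>) (k, meq k))"
    by (rule continuous_on_compose2[OF continuous_on_integral_switch[OF continuous_on_margin]])
      (use meq in \<open>auto intro!: continuous_intros continuous_on_meq simp: case_prod_beta\<close>)
  then show ?thesis by (simp add: profit_def[abs_def])
qed

section \<open>Equilibria and the maximising contract\<close>

text \<open>Efforts are forced by uniqueness of minimisers and participation is forced away from
  ties. The mean condition then says that the mean effort is a fixed point of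
  \<open>response k\<close>, which leaves only \<open>meq k\<close>.\<close>

lemma equilibrium_characterization:
  assumes k: "k \<in> K" and M: "M \<in> mf_equilibria x \<mu> lam Emax \<pi> k"
  shows "mean_effort M = meq k"
    and "\<And>\<theta>. \<theta> \<in> \<Theta> \<Longrightarrow> effort_in M \<theta> = eff k \<theta> (meq k)"
    and "\<And>\<theta>. \<theta> \<in> \<Theta> \<Longrightarrow> effort_out M \<theta> = eff (0, 0, 0) \<theta> (meq k)"
    and "AE \<theta> in \<pi>. participation M \<theta> = (if gap k \<theta> (meq k) < 0 then 1 else 0)"
proof -
  let ?m = "mean_effort M"
  have k0: "k \<in> K0" using k K_subset by auto
  have m: "?m \<in> {0..Emax}"
    and meas [measurable]: "effort_in M \<in> borel_measurable \<pi>" "effort_out M \<in> borel_measurable \<pi>"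
      "participation M \<in> borel_measurable \<pi>"
    and mean: "?m = (\<integral>\<theta>. (participation M \<theta> * effort_in M \<theta>
        + (1 - participation M \<theta>) * effort_out M \<theta>) \<partial>\<pi>)"
    using M by (auto simp: mf_equilibria_def)
  have e_in: "effort_in M \<theta> = eff k \<theta> ?m" and e_out: "effort_out M \<theta> = eff (0, 0, 0) \<theta> ?m"
    if "\<theta> \<in> \<Theta>" for \<theta>
    using M that m k0 outside_in_K0 by (auto simp: mf_equilibria_def E_out_eq intro!: eff_unique)
  have q: "participation M \<theta> = (if gap k \<theta> ?m < 0 then 1 else 0)" if \<theta>: "\<theta> \<in> \<Theta>" and "gap k \<theta> ?m \<noteq> 0" for \<theta>
  proof -
    have "0 < fst \<theta>" using \<theta> \<Theta>_bounds by (auto simp: \<Theta>_def)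
    note U = U_less_iff[OF this]
    have "(gap k \<theta> ?m < 0 \<longrightarrow> participation M \<theta> = 1) \<and> (gap k \<theta> ?m > 0 \<longrightarrow> participation M \<theta> = 0)"
      using M \<theta> by (simp add: mf_equilibria_def U e_in e_out gap_def val_def)
    then show ?thesis using that by auto
  qed
  have AE: "AE \<theta> in \<pi>. participation M \<theta> = (if gap k \<theta> ?m < 0 then 1 else 0)"
    using AE_gap_nonzero[OF k m] AE_space by eventually_elim (use q in auto)
  have "response k ?m = (\<integral>\<theta>. (participation M \<theta> * effort_in M \<theta>
      + (1 - participation M \<theta>) * effort_out M \<theta>) \<partial>\<pi>)"
    unfolding response_def
  proof (rule integral_cong_AE)
    show "AE \<theta> in \<pi>. switch eff (\<lambda>_. eff (0, 0, 0)) k ?m \<theta> = participation M \<theta> * effort_in M \<theta>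
        + (1 - participation M \<theta>) * effort_out M \<theta>"
      using AE AE_space by eventually_elim (simp add: switch_def e_in e_out)
  qed (use response_measurable k m in auto)
  then have meq: "?m = meq k" using meq_unique[OF k m] mean by simp
  then show "mean_effort M = meq k"
    and "\<And>\<theta>. \<theta> \<in> \<Theta> \<Longrightarrow> effort_in M \<theta> = eff k \<theta> (meq k)"
    and "\<And>\<theta>. \<theta> \<in> \<Theta> \<Longrightarrow> effort_out M \<theta> = eff (0, 0, 0) \<theta> (meq k)"
    and "AE \<theta> in \<pi>. participation M \<theta> = (if gap k \<theta> (meq k) < 0 then 1 else 0)"
    using e_in e_out AE by auto
qed

lemma equilibrium_exists:
  assumes k: "k \<in> K" shows "mf_equilibria x \<mu> lam Emax \<pi> k \<noteq> {}"
proof -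
  let ?m = "meq k"
  \<comment> \<open>Indifferent types stay out, the same convention as in \<open>switch\<close>, so
    the two integrands in the mean condition agree at every type.\<close>
  define M where "M = \<lparr>mean_effort = ?m, effort_in = (\<lambda>\<theta>. eff k \<theta> ?m),
    effort_out = (\<lambda>\<theta>. eff (0, 0, 0) \<theta> ?m), participation = (\<lambda>\<theta>. if gap k \<theta> ?m < 0 then 1 else 0)\<rparr>"
  have k0: "k \<in> K0" using k K_subset by auto
  note m = meq(1)[OF k]
  have [measurable]: "(\<lambda>\<theta>. eff k \<theta> ?m) \<in> borel_measurable \<pi>"
    "(\<lambda>\<theta>. eff (0, 0, 0) \<theta> ?m) \<in> borel_measurable \<pi>" "(\<lambda>\<theta>. gap k \<theta> ?m) \<in> borel_measurable \<pi>"
    using k m continuous_on_section[OF continuous_on_eff_in] continuous_on_section[OF continuous_on_eff_out]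
      continuous_on_gap_section by (blast intro: measurable_pi_continuous)+
  have "M \<in> mf_equilibria x \<mu> lam Emax \<pi> k"
    unfolding mf_equilibria_def mem_Collect_eq
  proof (intro conjI ballI)
    fix \<theta> assume "\<theta> \<in> space \<pi>"
    then have \<theta>: "\<theta> \<in> \<Theta>" by simp
    have "0 < fst \<theta>" using \<theta> \<Theta>_bounds by (auto simp: \<Theta>_def)
    note U = U_less_iff[OF this]
    show "effort_out M \<theta> \<in> E_out x \<mu> lam Emax \<theta> (mean_effort M)"
      "effort_in M \<theta> \<in> E_in x \<mu> lam Emax k \<theta> (mean_effort M)"
      using eff_mem_E_in[OF k0 \<theta> m] eff_mem_E_in[OF outside_in_K0 \<theta> m]
      by (simp_all add: M_def E_out_eq)
    show "participation M \<theta> \<in> {0..1}" by (simp add: M_def)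
    show "U_out x \<mu> lam (effort_out M \<theta>) \<theta> (mean_effort M)
        < U_in x \<mu> lam k (effort_in M \<theta>) \<theta> (mean_effort M) \<longrightarrow> participation M \<theta> = 1"
      "U_in x \<mu> lam k (effort_in M \<theta>) \<theta> (mean_effort M)
        < U_out x \<mu> lam (effort_out M \<theta>) \<theta> (mean_effort M) \<longrightarrow> participation M \<theta> = 0"
      by (simp_all add: M_def U gap_def val_def)
  next
    have "response k ?m = (\<integral>\<theta>. (participation M \<theta> * effort_in M \<theta>
        + (1 - participation M \<theta>) * effort_out M \<theta>) \<partial>\<pi>)"
      unfolding response_def
      by (intro Bochner_Integration.integral_cong) (auto simp: M_def switch_def)
    then show "mean_effort M = (\<integral>\<theta>. (participation M \<theta> * effort_in M \<theta>
        + (1 - participation M \<theta>) * effort_out M \<theta>) \<partial>\<pi>)"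
      by (simp add: meq(2)[OF k]) (simp add: M_def)
  qed (use m in \<open>simp_all add: M_def\<close>)
  then show ?thesis by blast
qed

lemma ae_unique_equilibrium:
  assumes k: "k \<in> K" shows "has_ae_unique_equilibrium x \<mu> lam Emax \<pi> k"
  unfolding has_ae_unique_equilibrium_def ae_equal_profiles_def
proof (intro conjI ballI)
  show "mf_equilibria x \<mu> lam Emax \<pi> k \<noteq> {}" by (rule equilibrium_exists[OF k])
  fix M M' assume M: "M \<in> mf_equilibria x \<mu> lam Emax \<pi> k" and M': "M' \<in> mf_equilibria x \<mu> lam Emax \<pi> k"
  note c = equilibrium_characterization[OF k M] and c' = equilibrium_characterization[OF k M']
  show "mean_effort M = mean_effort M'" by (simp add: c c')
  show "AE \<theta> in \<pi>. effort_in M \<theta> = effort_in M' \<theta> \<and> effort_out M \<theta> = effort_out M' \<theta> \<and>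
      participation M \<theta> = participation M' \<theta>"
    using c(4) c'(4) AE_space by eventually_elim (simp add: c(2,3) c'(2,3))
qed

text \<open>Equilibria differ only on a null set of participation decisions, which the integral
  ignores; the profit is thus independent of the representative.\<close>

lemma insurer_profit_eq:
  assumes k: "k \<in> K" and M: "M \<in> mf_equilibria x \<mu> lam Emax \<pi> k"
  shows "insurer_profit x \<mu> \<pi> k M = profit k"
proof -
  note c = equilibrium_characterization[OF k M]
  have [measurable]: "participation M \<in> borel_measurable \<pi>" using M by (simp add: mf_equilibria_def)
  have marg [measurable]: "(\<lambda>\<theta>. margin k \<theta> (meq k)) \<in> borel_measurable \<pi>"
    using k meq continuous_on_section[OF continuous_on_margin] by (blast intro: measurable_pi_continuous)
  have "insurer_profit x \<mu> \<pi> k M = (\<integral>\<theta>. margin k \<theta> (meq k) * participation M \<theta> \<partial>\<pi>)"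
    unfolding insurer_profit_def case_prod_beta
    by (intro Bochner_Integration.integral_cong) (auto simp: margin_def c)
  also have "\<dots> = profit k"
    unfolding profit_def
  proof (rule integral_cong_AE)
    show "AE \<theta> in \<pi>. margin k \<theta> (meq k) * participation M \<theta> = switch margin (\<lambda>_ _ _. 0) k (meq k) \<theta>"
      using c(4) by eventually_elim (simp add: switch_def)
  qed (use switch_measurable[OF continuous_on_margin] k meq in \<open>auto simp: case_prod_beta\<close>)
  finally show ?thesis .
qed

end

theorem proposition4p1:
  fixes x Emax pmax \<alpha>min \<alpha>max \<beta>max \<gamma>min \<gamma>max cmax \<sigma>min \<sigma>max L\<mu> Llam Cf :: real
    and \<mu> lam :: "real \<Rightarrow> real"
    and \<Theta> :: "agent set"
    and \<pi> :: "agent measure"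
    and f :: "agent \<Rightarrow> ennreal"
    and K :: "contract set"
  assumes x: "0 \<le> x" "x < 1"
    and lam_nonneg: "\<And>y. 0 \<le> y \<Longrightarrow> 0 \<le> lam y"
    and K_def: "K = {0..pmax} \<times> {\<alpha>min..\<alpha>max} \<times> {0..\<beta>max}"
    and K_bounds: "0 \<le> pmax" "0 < \<alpha>min" "\<alpha>min \<le> \<alpha>max" "0 \<le> \<beta>max" "\<beta>max < 1"
    and U1: "0 \<le> Emax"
    and U2_mu: "continuous_on {0..(1 + x) * Emax} \<mu>"
      "strictly_convex_on {0..(1 + x) * Emax} \<mu>"
      "L\<mu> > 0" "L\<mu>-lipschitz_on {0..(1 + x) * Emax} \<mu>"
    and U2_lam: "continuous_on {0..(1 + x) * Emax} lam"
      "strictly_convex_on {0..(1 + x) * Emax} lam"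
      "Llam > 0" "Llam-lipschitz_on {0..(1 + x) * Emax} lam"
    and U3: "\<Theta> = {\<gamma>min..\<gamma>max} \<times> {0..cmax} \<times> {\<sigma>min..\<sigma>max}"
      "0 < \<gamma>min" "\<gamma>min < \<gamma>max" "0 < cmax" "0 < \<sigma>min" "\<sigma>min < \<sigma>max"
    and prob: "prob_space \<pi>"
    and U5: "f \<in> borel_measurable (restrict_space lborel \<Theta>)"
      "\<pi> = density (restrict_space lborel \<Theta>) f"
      "esssup (restrict_space lborel \<Theta>) f \<le> ennreal Cf"
    and U6: "(SUP k\<in>K. 3 * x + Emax * C_q x \<gamma>min \<gamma>max cmax \<sigma>min L\<mu> Llam Cf k) < 1"
  shows "(\<forall>k\<in>K. has_ae_unique_equilibrium x \<mu> lam Emax \<pi> k) \<and>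
    (\<exists>Juniq :: contract \<Rightarrow> real.
       (\<forall>k\<in>K. \<forall>M\<in>mf_equilibria x \<mu> lam Emax \<pi> k. insurer_profit x \<mu> \<pi> k M = Juniq k) \<and>
       continuous_on K Juniq \<and>
       (\<exists>kstar\<in>K.
          (\<forall>k\<in>K. Juniq k \<le> Juniq kstar) \<and>
          (\<forall>R. (\<forall>k\<in>K. R k \<in> mf_equilibria x \<mu> lam Emax \<pi> k) \<longrightarrow>
             exact_stackelberg x \<mu> lam Emax \<pi> K R (kstar, R kstar))))"
proof -
  interpret insurance_game x Emax pmax \<alpha>min \<alpha>max \<beta>max \<gamma>min \<gamma>max cmax \<sigma>min \<sigma>max L\<mu> Llam Cf \<mu> lam \<Theta> \<pi> f K
    by (rule insurance_game.intro; fact assms)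
  obtain kstar where kstar: "kstar \<in> K" "\<And>k. k \<in> K \<Longrightarrow> profit k \<le> profit kstar"
    using continuous_attains_sup[OF compact_K K_nonempty continuous_on_profit] by blast
  show ?thesis
  \<comment> \<open>\<open>profit\<close> serves as \<open>Juniq\<close>. Since \<open>kstar\<close>
    maximises it without reference to any selection, the same contract works for every choice
    \<open>R\<close> of representatives.\<close>
  proof (intro conjI exI[of _ profit] bexI[of _ kstar] ballI allI impI)
    fix R assume "\<forall>k\<in>K. R k \<in> mf_equilibria x \<mu> lam Emax \<pi> k"
    then show "exact_stackelberg x \<mu> lam Emax \<pi> K R (kstar, R kstar)"
      using kstar ae_unique_equilibrium insurer_profit_eq by (simp add: exact_stackelberg_def)
  qed (use kstar ae_unique_equilibrium insurer_profit_eq continuous_on_profit in auto)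
qed

end
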